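(* Let $n\ge2$ and $p\in\mathbb{N}$. For any $K\in\mathcal{K}(\mathbb{R}^n)$ with $0\in K$ and any $\bm t=(t_0,\dots,t_p)\in\Theta_p$, one has $$|R_{p,\bm t,K}|\leq\frac{(n!)^p}{(np)!}\sum_{\bm j\in\mathcal{J}^n_p}\binom{n}{\bm j}\bm t^{\,n-\bm j}|K|^p,$$ where $R_{p,\bm t,K}=\mathrm{conv}\big(-t_0\Delta_pK\cup t_1\iota_1K\cup\dots\cup t_p\iota_pK\big)\subset\mathbb{R}^{np}$. If $\dim(K)=n$ and equality holds for some $\bm t\in\mathrm{relint}(\Theta_p)$, then $K$ is a simplex with a vertex at the origin.
   Context: $\mathcal{K}(\mathbb{R}^n)$ denotes the set of convex bodies, i.e. nonempty compact convex subsets of $\mathbb{R}^n$; $|\cdot|$ is Lebesgue measure (in the dimension of the ambient space); $\dim K$ is the dimension of the affine span of $K$; a simplex is the convex hull of affinely independent points (its vertices). Identify $\mathbb{R}^{pn}=(\mathbb{R}^n)^p$; $\Delta_p(x)=(x,\dots,x)$ is the diagonal embedding $\mathbb{R}^n\to\mathbb{R}^{pn}$ and $\iota_i:\mathbb{R}^n\to\mathbb{R}^{pn}$, $1\le i\le p$, the inclusion into the $i$-th factor. $\mathcal{J}_p^n=\{\bm j=(j_0,\dots,j_p)\in\mathbb{N}_0^{p+1}:j_0+\dots+j_p=n\}$; $\binom{n}{\bm j}=\frac{n!}{j_0!\cdots j_p!}$. $\Theta_p=\{(t_0,\dots,t_p)\in\mathbb{R}^{p+1}:t_l\ge0,\ t_0+\dots+t_p=1\}$,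 with relative interior $\mathrm{relint}(\Theta_p)$ (all $t_l>0$); $\bm t^{\,n-\bm j}=\prod_{l=0}^pt_l^{n-j_l}$, with $0^0=1$. *)

theory Defs
  imports "HOL-Analysis.Analysis"
begin

text \<open>
  The space \<open>(\<real>\<^sup>n)\<^sup>p\<close> is the type \<open>real ^ 'n ^ 'p\<close> with \<open>n = CARD('n)\<close> and \<open>p = CARD('p)\<close> (so
  \<open>p \<ge> 1\<close>). The index set \<open>{0, \<dots>, p}\<close> is the type \<open>'p option\<close>: \<open>None\<close> is the index \<open>0\<close>, and
  \<open>Some i\<close> is the index of the \<open>i\<close>-th factor. The inclusion of the \<open>i\<close>-th factor is the library's
  \<open>axis i\<close>.
\<close>

definition convex_body :: "(real ^ 'n) set \<Rightarrow> bool" where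
  "convex_body K \<longleftrightarrow> K \<noteq> {} \<and> compact K \<and> convex K"

definition diag :: "real ^ 'n \<Rightarrow> real ^ 'n ^ 'p" where
  "diag x = (\<chi> i. x)"

definition R_body :: "real ^ ('p option) \<Rightarrow> (real ^ 'n) set \<Rightarrow> (real ^ 'n ^ 'p) set" where
  "R_body t K =
     convex hull ((\<lambda>x. (- (t $ None)) *\<^sub>R diag x) ` K \<union> (\<Union>i. (\<lambda>x. (t $ Some i) *\<^sub>R axis i x) ` K))"

definition Theta :: "(real ^ ('p::finite option)) set" where
  "Theta = {t. (\<forall>l. 0 \<le> t $ l) \<and> (\<Sum>l\<in>UNIV. t $ l) = 1}"

definition multi_indices :: "nat \<Rightarrow> ('p::finite option \<Rightarrow> nat) set" where
  "multi_indices n = {j. (\<Sum>l\<in>UNIV. j l) = n}"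

definition multinomial :: "nat \<Rightarrow> ('p::finite option \<Rightarrow> nat) \<Rightarrow> real" where
  "multinomial n j = fact n / (\<Prod>l\<in>UNIV. fact (j l))"

text \<open>On \<open>multi_indices n\<close> the natural-number subtraction below never truncates.\<close>

definition monomial_compl :: "nat \<Rightarrow> real ^ ('p::finite option) \<Rightarrow> ('p option \<Rightarrow> nat) \<Rightarrow> real" where
  "monomial_compl n t j = (\<Prod>l\<in>UNIV. (t $ l) ^ (n - j l))"

definition R_bound :: "real ^ ('p::finite option) \<Rightarrow> (real ^ 'n) set \<Rightarrow> real" where
  "R_bound t K =
     fact CARD('n) ^ CARD('p) / fact (CARD('n) * CARD('p)) *
     (\<Sum>j\<in>multi_indices CARD('n). multinomial CARD('n) j * monomial_compl CARD('n) t j) *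
     measure lebesgue K ^ CARD('p)"

definition simplex_with_vertex :: "(real ^ 'n) set \<Rightarrow> real ^ 'n \<Rightarrow> bool" where
  "simplex_with_vertex K v \<longleftrightarrow> (\<exists>V. \<not> affine_dependent V \<and> K = convex hull V \<and> v \<in> V)"

end

theory Submission
  imports Defs
begin

text \<open>
  Let \<open>N\<close> be the gauge of \<open>K\<close>, equal to \<open>\<infinity>\<close> off the cone \<open>C\<close> spanned by \<open>K\<close>. For \<open>t > 0\<close> substitute
  \<open>x\<^sub>0 = w / t\<^sub>0\<close>, \<open>x\<^sub>i = (y\<^sub>i + w) / t\<^sub>i\<close> in the integral of \<open>exp (- \<Sum>\<^sub>l N(x\<^sub>l))\<close>, which is
  \<open>(\<Prod>\<^sub>l t\<^sub>l)\<^sup>n (n! |K|)\<^sup>p\<^sup>+\<^sup>1\<close>. Since \<open>N\<close> is subadditive, the fibre over \<open>y\<close> contributes at least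
  \<open>exp (- \<parallel>y\<parallel>\<^sub>R)\<close> times the fibre integral of \<open>exp (- c N)\<close>, where \<open>c = \<Sum>\<^sub>l 1 / t\<^sub>l\<close>, and integrating
  over \<open>y\<close> gives the volume of \<open>R\<close>. Degenerate \<open>t\<close> follow because \<open>R\<close> is monotone in \<open>t\<close>.

  In the equality case every fibre inequality is sharp. This forces \<open>N\<close> to be additive on \<open>C\<close> and any
  intersection \<open>C \<inter> (C - u)\<close> to be a translate of \<open>C\<close>, so \<open>C\<close> is a lattice cone. By Riesz decomposition
  the nonzero extreme points of \<open>K\<close> are linearly independent.
\<close>

section \<open>The Minkowski functional of a compact convex set containing the origin\<close>

text \<open>Real-valued: off \<open>cone hull B\<close> this is the infimum of the empty set and
  carries no information, so uses are guarded by cone membership.\<close>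

definition minkowski :: "'a::real_vector set \<Rightarrow> 'a \<Rightarrow> real" where
  "minkowski B x = Inf {s. 0 \<le> s \<and> x \<in> (*\<^sub>R) s ` B}"

text \<open>\<open>exp (- N)\<close> for the extended-valued gauge \<open>N\<close>, which is \<open>\<infinity>\<close> off the cone spanned by \<open>B\<close>.\<close>

definition exp_gauge :: "'a::real_vector set \<Rightarrow> 'a \<Rightarrow> real" where
  "exp_gauge B x = (if x \<in> cone hull B then exp (- minkowski B x) else 0)"

lemma exp_gauge_nonneg [simp]: "0 \<le> exp_gauge B x"
  and exp_gauge_pos_iff: "0 < exp_gauge B x \<longleftrightarrow> x \<in> cone hull B"
  by (auto simp: exp_gauge_def)

lemma mem_cone_hull_iff: "x \<in> cone hull B \<longleftrightarrow> (\<exists>s\<ge>0. x \<in> (*\<^sub>R) s ` B)"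
  unfolding cone_hull_expl by blast

locale gauge_body =
  fixes B :: "'a::euclidean_space set"
  assumes comp: "compact B" and conv: "convex B" and zero_mem: "0 \<in> B"
begin

lemma mem_scale_mono:
  assumes "x \<in> (*\<^sub>R) s ` B" "0 \<le> s" "s \<le> s'"
  shows "x \<in> (*\<^sub>R) s' ` B"
proof (cases "s' = 0")
  case True
  then show ?thesis using assms by auto
next
  case False
  obtain b where b: "b \<in> B" "x = s *\<^sub>R b" using assms by auto
  have "(s / s') *\<^sub>R b \<in> B"
    using mem_convex_alt[OF conv b(1) zero_mem, of "s / s'" "1 - s / s'"] assms False by simp
  moreover have "x = s' *\<^sub>R ((s / s') *\<^sub>R b)" using b False by simp
  ultimately show ?thesis by blast
qed

text \<open>Membership asks for a witness in \<open>B\<close>, and projecting out a compact factor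
  keeps closedness. This yields attainment of the infimum and joint measurability for the layer-cake
  integral.\<close>

lemma closed_scale_graph: "closed {z::real \<times> 'a. 0 \<le> fst z \<and> snd z \<in> (*\<^sub>R) (fst z) ` B}"
proof -
  let ?T = "{z::'a \<times> (real \<times> 'a). 0 \<le> fst (snd z)} \<inter> {z. snd (snd z) = fst (snd z) *\<^sub>R fst z}"
  have "closed ?T"
    by (intro closed_Int closed_Collect_le closed_Collect_eq continuous_intros)
  from closed_compact_projection[OF comp this]
  show ?thesis by (rule back_subst[of closed]) auto
qed

lemma closed_scale: "0 \<le> s \<Longrightarrow> closed ((*\<^sub>R) s ` B)"
  using comp compact_imp_closed compact_scaling by blast

lemma closed_scales: "closed {s. 0 \<le> s \<and> x \<in> (*\<^sub>R) s ` B}"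
proof -
  have "closed ((\<lambda>s. (s, x)) -` {z::real \<times> 'a. 0 \<le> fst z \<and> snd z \<in> (*\<^sub>R) (fst z) ` B})"
    by (intro closed_vimage closed_scale_graph continuous_intros)
  then show ?thesis by (simp add: vimage_def)
qed

lemma minkowski_props:
  assumes "x \<in> cone hull B"
  shows minkowski_nonneg: "0 \<le> minkowski B x"
    and minkowski_attained: "x \<in> (*\<^sub>R) (minkowski B x) ` B"
proof -
  let ?S = "{s. 0 \<le> s \<and> x \<in> (*\<^sub>R) s ` B}"
  have "Inf ?S \<in> ?S"
    using assms by (intro closed_contains_Inf closed_scales) (auto simp: mem_cone_hull_iff)
  then show "0 \<le> minkowski B x" "x \<in> (*\<^sub>R) (minkowski B x) ` B"
    by (auto simp: minkowski_def)
qed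

lemma minkowski_le:
  assumes "0 \<le> s" "x \<in> (*\<^sub>R) s ` B"
  shows "minkowski B x \<le> s"
  unfolding minkowski_def using assms by (intro cInf_lower) auto

lemma mem_scale_iff:
  assumes "0 \<le> s"
  shows "x \<in> (*\<^sub>R) s ` B \<longleftrightarrow> x \<in> cone hull B \<and> minkowski B x \<le> s"
  using assms minkowski_le[of s x] minkowski_props[of x] mem_scale_mono[of x "minkowski B x" s]
  by (auto simp: mem_cone_hull_iff)

lemma mem_iff: "x \<in> B \<longleftrightarrow> x \<in> cone hull B \<and> minkowski B x \<le> 1"
  using mem_scale_iff[of 1 x] by simp

lemma zero_cone [simp]: "0 \<in> cone hull B"
  using zero_mem hull_inc by fast

lemma minkowski_zero [simp]: "minkowski B 0 = 0"
  using minkowski_le[of 0 0] minkowski_nonneg[of 0] zero_mem by force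

lemma scale_cone: "x \<in> cone hull B \<Longrightarrow> 0 \<le> a \<Longrightarrow> a *\<^sub>R x \<in> cone hull B"
  by (rule mem_cone[OF cone_cone_hull])

lemma scale_cone_iff: "0 < a \<Longrightarrow> a *\<^sub>R x \<in> cone hull B \<longleftrightarrow> x \<in> cone hull B"
  using scale_cone[of x a] scale_cone[of "a *\<^sub>R x" "inverse a"] by auto

lemma minkowski_scale:
  assumes x: "x \<in> cone hull B" and a: "0 \<le> a"
  shows "minkowski B (a *\<^sub>R x) = a * minkowski B x"
proof -
  have le: "minkowski B (c *\<^sub>R z) \<le> c * minkowski B z" if "z \<in> cone hull B" "0 \<le> c" for c z
  proof -
    have "c *\<^sub>R z \<in> (*\<^sub>R) (c * minkowski B z) ` B"
      using minkowski_attained[OF that(1)] 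
      by (auto simp: image_iff) (metis scaleR_scaleR)
    then show ?thesis using that by (intro minkowski_le mult_nonneg_nonneg minkowski_nonneg)
  qed
  show ?thesis
  proof (cases "a = 0")
    case False
    with a have "0 < a" by simp
    have "minkowski B x = minkowski B (inverse a *\<^sub>R a *\<^sub>R x)" using False by simp
    also have "\<dots> \<le> inverse a * minkowski B (a *\<^sub>R x)"
      using x a by (intro le scale_cone) auto
    finally have "a * minkowski B x \<le> minkowski B (a *\<^sub>R x)"
      using \<open>0 < a\<close> by (simp add: field_simps)
    with le[OF x a] show ?thesis by simp
  qed simp
qed

lemma cone_convex: "convex (cone hull B)"
  using conv by (rule convex_cone_hull)

lemma add_cone: "x \<in> cone hull B \<Longrightarrow> y \<in> cone hull B \<Longrightarrow> x + y \<in> cone hull B"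
  using cone_convex cone_cone_hull[of B] convex_cone[of "cone hull B"] by blast

lemma minkowski_add:
  assumes x: "x \<in> cone hull B" and y: "y \<in> cone hull B"
  shows "minkowski B (x + y) \<le> minkowski B x + minkowski B y"
proof -
  let ?s = "minkowski B x" and ?t = "minkowski B y"
  obtain b c where b: "b \<in> B" "x = ?s *\<^sub>R b" and c: "c \<in> B" "y = ?t *\<^sub>R c"
    using minkowski_attained[OF x] minkowski_attained[OF y] by auto
  have nn: "0 \<le> ?s" "0 \<le> ?t" using x y by (auto intro: minkowski_nonneg)
  show ?thesis
  proof (cases "?s + ?t = 0")
    case True
    then have "?s = 0" "?t = 0" using nn by linarith+
    then have "x = 0" "y = 0" using b c by (metis scale_zero_left)+
    then show ?thesis by simp
  next
    case False
    let ?d = "(?s / (?s + ?t)) *\<^sub>R b + (?t / (?s + ?t)) *\<^sub>R c"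
    have "?d \<in> B"
      using nn False by (intro convexD[OF conv b(1) c(1)]) (auto simp: add_divide_distrib[symmetric])
    moreover have "x + y = (?s + ?t) *\<^sub>R ?d"
      using False b(2) c(2) by (simp add: scaleR_add_right)
    ultimately show ?thesis using nn by (intro minkowski_le) auto
  qed
qed

lemma minkowski_eq_0_iff:
  assumes "x \<in> cone hull B"
  shows "minkowski B x = 0 \<longleftrightarrow> x = 0"
  using minkowski_attained[OF assms] by auto

lemma scale_interior:
  assumes "x \<in> interior (cone hull B)" "0 < a"
  shows "a *\<^sub>R x \<in> interior (cone hull B)"
proof -
  have "(*\<^sub>R) a ` interior (cone hull B) \<subseteq> interior (cone hull B)"
    using assms(2) interior_subset[of "cone hull B"] by (intro interior_maximal) (auto simp: scale_cone open_scaling)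
  with assms show ?thesis by blast
qed

text \<open>Moving an interior point \<open>v\<close> slightly along \<open>u\<close> stays in the
  interior; dividing by the step size turns the small move into the full translation.\<close>

lemma ex_translate_interior:
  assumes "interior (cone hull B) \<noteq> {}"
  obtains w where "w \<in> interior (cone hull B)" "w + u \<in> interior (cone hull B)"
proof -
  obtain v where v: "v \<in> interior (cone hull B)" using assms by blast
  have "((\<lambda>a. v + a *\<^sub>R u) \<longlongrightarrow> v + 0 *\<^sub>R u) (at_right 0)"
    by (intro tendsto_intros)
  then have "eventually (\<lambda>a. v + a *\<^sub>R u \<in> interior (cone hull B)) (at_right (0::real))"
    using v by (intro topological_tendstoD[where S = "interior (cone hull B)"]) auto
  then obtain b :: real where "0 < b" "\<forall>a>0. a < b \<longrightarrow> v + a *\<^sub>R u \<in> interior (cone hull B)"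
    unfolding eventually_at_right_field by blast
  then obtain a :: real where a: "0 < a" "v + a *\<^sub>R u \<in> interior (cone hull B)"
    using dense[of 0 b] by blast
  then have "inverse a *\<^sub>R v \<in> interior (cone hull B)" "inverse a *\<^sub>R v + u \<in> interior (cone hull B)"
    using scale_interior[OF v, of "inverse a"] scale_interior[OF a(2), of "inverse a"] by (auto simp: scaleR_add_right)
  then show ?thesis using that by blast
qed

section \<open>Regularity and integral of \<open>exp_gauge\<close>\<close>

lemma exp_gauge_le1 [simp]: "exp_gauge B x \<le> 1"
  using minkowski_nonneg[of x] by (simp add: exp_gauge_def)

lemma exp_gauge_ge_iff:
  assumes "0 \<le> s"
  shows "exp (- s) \<le> exp_gauge B x \<longleftrightarrow> x \<in> (*\<^sub>R) s ` B"
  using mem_scale_iff[OF assms, of x] by (auto simp: exp_gauge_def not_le)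

lemma exp_gauge_add: "exp_gauge B x * exp_gauge B y \<le> exp_gauge B (x + y)"
  using minkowski_add[of x y] add_cone[of x y] by (auto simp: exp_gauge_def simp flip: exp_add)

text \<open>Superlevel sets are multiples of \<open>B\<close>, so \<open>exp_gauge B\<close> is upper semicontinuous.\<close>

lemma closed_exp_gauge_ge: "closed {x. c \<le> exp_gauge B x}"
proof -
  consider "c \<le> 0" | "1 < c" | "0 < c" "c \<le> 1" by linarith
  then show ?thesis
  proof cases
    case 1
    then have "{x. c \<le> exp_gauge B x} = UNIV" using order_trans[OF _ exp_gauge_nonneg[of B]] by auto
    then show ?thesis by simp
  next
    case 2
    then have "{x. c \<le> exp_gauge B x} = {}" using le_less_trans[OF exp_gauge_le1[of _]] by (auto simp: not_le)
    then show ?thesis by simp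
  next
    case 3
    then have "c = exp (- (- ln c))" "0 \<le> - ln c" by auto
    then have "{x. c \<le> exp_gauge B x} = (*\<^sub>R) (- ln c) ` B"
      using exp_gauge_ge_iff by (metis (no_types, lifting) Collect_cong Collect_mem_eq)
    then show ?thesis using closed_scale[OF \<open>0 \<le> - ln c\<close>] by metis
  qed
qed

lemma exp_gauge_measurable [measurable]: "exp_gauge B \<in> borel_measurable borel"
  by (rule borel_measurable_iff_ge[THEN iffD2]) (auto intro: borel_closed closed_exp_gauge_ge)

lemma minkowski_convex_on: "convex_on (cone hull B) (minkowski B)"
proof (rule convex_onI)
  fix t :: real and x y assume t: "0 < t" "t < 1" and xy: "x \<in> cone hull B" "y \<in> cone hull B"
  show "minkowski B ((1 - t) *\<^sub>R x + t *\<^sub>R y) \<le> (1 - t) * minkowski B x + t * minkowski B y"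
    using minkowski_add[of "(1 - t) *\<^sub>R x" "t *\<^sub>R y"] t xy by (simp add: scale_cone minkowski_scale)
qed (rule cone_convex)

lemma continuous_on_minkowski: "continuous_on (interior (cone hull B)) (minkowski B)"
  by (intro convex_on_continuous open_interior convex_on_subset[OF minkowski_convex_on])
    (auto simp: interior_subset convex_interior cone_convex)

text \<open>Convexity makes the gauge continuous in the interior, and off the closure the function
  vanishes locally. As the frontier of a convex set is null, this is continuity almost
  everywhere.\<close>

lemma isCont_exp_gauge:
  assumes "x \<notin> frontier (cone hull B)"
  shows "isCont (exp_gauge B) x"
proof (cases "x \<in> interior (cone hull B)")
  case True
  have "continuous_on (interior (cone hull B)) (\<lambda>x. exp (- minkowski B x))"
    by (intro continuous_intros continuous_on_minkowski)
  then have "isCont (\<lambda>x. exp (- minkowski B x)) x"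
    using True by (simp add: continuous_on_eq_continuous_at)
  moreover have "eventually (\<lambda>x. exp_gauge B x = exp (- minkowski B x)) (nhds x)"
    using True interior_subset[of "cone hull B"]
    by (auto simp: exp_gauge_def eventually_nhds intro!: exI[of _ "interior (cone hull B)"])
  ultimately show ?thesis by (simp add: isCont_cong)
next
  case False
  with assms have x: "x \<in> - closure (cone hull B)" by (auto simp: frontier_def)
  have "eventually (\<lambda>x. exp_gauge B x = 0) (nhds x)"
    using x closure_subset[of "cone hull B"]
    by (auto simp: exp_gauge_def eventually_nhds intro!: exI[of _ "- closure (cone hull B)"])
  then show ?thesis using isCont_cong[of "exp_gauge B" "\<lambda>_. 0"] by simp
qed

text \<open>Layer cake: on the cone, \<open>exp (- minkowski B x)\<close> is the integral of
  \<open>exp (- s)\<close> over \<open>s\<close> from the gauge upwards. After exchanging the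
  integrals the slice at \<open>s\<close> is a dilate of \<open>B\<close>, and a Gamma integral
  remains.\<close>

lemma nn_integral_exp_gauge:
  "(\<integral>\<^sup>+x. ennreal (exp_gauge B x) \<partial>lborel) = fact DIM('a) * emeasure lborel B"
proof -
  let ?A = "{z::real \<times> 'a. 0 \<le> fst z \<and> snd z \<in> (*\<^sub>R) (fst z) ` B}"
  let ?h = "\<lambda>s (x::'a). ennreal (exp (- s)) * indicator ?A (s, x)"
  have exp_tail: "(\<integral>\<^sup>+s. ennreal (exp (- s)) * indicator {a..} s \<partial>lborel) = ennreal (exp (- a))"
    for a :: real
  proof -
    have "((\<lambda>s::real. - exp (- s)) \<longlongrightarrow> - 0) at_top"
      by (intro tendsto_minus filterlim_compose[OF exp_at_bot] filterlim_uminus_at_bot_at_top)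
    then show ?thesis
      by (subst nn_integral_FTC_atLeast[where F = "\<lambda>s. - exp (- s)" and T = "- 0"])
        (auto intro!: derivative_eq_intros)
  qed
  have layer: "(\<integral>\<^sup>+s. ?h s x \<partial>lborel) = ennreal (exp_gauge B x)" for x
  proof (cases "x \<in> cone hull B")
    case True
    have "indicator ?A (s, x) = (indicator {minkowski B x..} s :: ennreal)" for s
      using mem_scale_iff[of s x] minkowski_nonneg[OF True] True
      by (auto simp: indicator_def)
    then show ?thesis using True by (simp add: exp_tail exp_gauge_def)
  next
    case False
    then have "indicator ?A (s, x) = (0 :: ennreal)" for s
      using mem_scale_iff[of s x] by (auto simp: indicator_def)
    then show ?thesis using False by (simp add: exp_gauge_def)
  qed
  \<comment> \<open>The Gamma integrand uses \<open>powr\<close>, which matches the natural power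
    for \<open>s > 0\<close>; the value \<open>s = 0\<close> is discarded as a null set.\<close>
  have slice: "(\<integral>\<^sup>+x. ?h s x \<partial>lborel) =
      emeasure lborel B * ennreal (indicator {0..} s * s powr (real DIM('a) + 1 - 1) / exp s)"
    if "s \<noteq> 0" for s
  proof (cases "0 \<le> s")
    case True
    have "(\<integral>\<^sup>+x. ?h s x \<partial>lborel) = ennreal (exp (- s)) * emeasure lborel ((*\<^sub>R) s ` B)"
    proof -
      have "?h s x = ennreal (exp (- s)) * indicator ((*\<^sub>R) s ` B) x" for x
        using True by (auto simp: indicator_def)
      then show ?thesis using closed_scale[OF True] by (simp add: nn_integral_cmult_indicator)
    qed
    also have "emeasure lborel ((*\<^sub>R) s ` B) = ennreal (s ^ DIM('a)) * emeasure lborel B"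
    proof -
      have "emeasure lborel ((*\<^sub>R) s ` B) = emeasure lebesgue ((*\<^sub>R) s ` B)"
        using closed_scale[OF True] by (subst emeasure_completion) auto
      also have "(*\<^sub>R) s ` B = (\<lambda>x. s *\<^sub>R x + 0) ` B" by simp
      also have "emeasure lebesgue \<dots> = ennreal (\<bar>s\<bar> ^ DIM('a)) * emeasure lebesgue B"
        using emeasure_lebesgue_affine[of s 0 B] by simp
      finally show ?thesis using True compact_imp_closed[OF comp] by (simp add: emeasure_completion)
    qed
    finally show ?thesis
      using True that
      by (simp add: powr_realpow exp_minus divide_inverse mult_ac flip: ennreal_mult mult.assoc)
  qed simp
  have "(\<integral>\<^sup>+x. ennreal (exp_gauge B x) \<partial>lborel) = (\<integral>\<^sup>+x. \<integral>\<^sup>+s. ?h s x \<partial>lborel \<partial>lborel)"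
    by (simp only: layer)
  also have "\<dots> = (\<integral>\<^sup>+s. \<integral>\<^sup>+x. ?h s x \<partial>lborel \<partial>lborel)"
  proof (rule lborel_pair.Fubini')
    have "(\<lambda>z. ennreal (exp (- fst z)) * indicator ?A z) \<in> borel_measurable borel"
      by (intro borel_measurable_times_ennreal measurable_compose[OF _ measurable_ennreal]
          borel_measurable_continuous_onI borel_measurable_indicator continuous_intros
          closed_scale_graph borel_closed)
    then show "case_prod ?h \<in> borel_measurable (lborel \<Otimes>\<^sub>M lborel)"
      by (simp add: lborel_prod split_beta')
  qed
  also have "\<dots> = (\<integral>\<^sup>+s. emeasure lborel B *
      ennreal (indicator {0..} s * s powr (real DIM('a) + 1 - 1) / exp s) \<partial>lborel)"
    using AE_lborel_singleton[of "0::real"] slice by (intro nn_integral_cong_AE) auto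
  also have "\<dots> = emeasure lborel B * ennreal (Gamma (real DIM('a) + 1))"
    by (subst nn_integral_cmult) (auto simp: Gamma_conv_nn_integral_real)
  also have "Gamma (real DIM('a) + 1) = fact DIM('a)"
    using Gamma_fact[of "DIM('a)", where 'a = real] by (simp add: add.commute)
  finally show ?thesis by (simp add: mult.commute flip: ennreal_fact)
qed

end

section \<open>Lebesgue measure\<close>

lemma vec_lambda_measurable:
  "vec_lambda \<in> measurable (Pi\<^sub>M UNIV (\<lambda>_::'p::finite. lborel :: 'a::euclidean_space measure)) borel"
proof (subst borel_measurable_euclidean_space, rule ballI)
  fix b :: "'a^'p" assume "b \<in> Basis"
  then obtain i u where b: "b = axis i u" by (auto simp: Basis_vec_def)
  have "(\<lambda>f. f i \<bullet> u) \<in> borel_measurable (Pi\<^sub>M UNIV (\<lambda>_::'p. lborel :: 'a measure))"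
    by measurable
  then show "(\<lambda>f. vec_lambda f \<bullet> b) \<in> borel_measurable (Pi\<^sub>M UNIV (\<lambda>_::'p. lborel :: 'a measure))"
    by (simp add: b inner_axis)
qed

text \<open>Lebesgue measure is determined by its values on boxes, and the volume of a box in the
  nested space factors over the coordinates \<open>i\<close>. This makes
  \<open>nn_integral_vec_prod\<close> available.\<close>

lemma lborel_vec:
  "(lborel :: ('a::euclidean_space ^ 'p::finite) measure) = distr (Pi\<^sub>M UNIV (\<lambda>_. lborel)) borel vec_lambda"
proof (rule lborel_eqI)
  fix l u :: "'a ^ 'p" assume le: "\<And>b. b \<in> Basis \<Longrightarrow> l \<bullet> b \<le> u \<bullet> b"
  interpret product_sigma_finite "\<lambda>_::'p. lborel :: 'a measure" ..
  have le': "l $ i \<bullet> b \<le> u $ i \<bullet> b" if "b \<in> Basis" for i b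
    using le[of "axis i b"] that by (simp add: inner_axis)
  have inj: "inj_on (\<lambda>(i, b). axis i b :: 'a ^ 'p) (UNIV \<times> Basis)"
    using nonzero_Basis by (auto simp: inj_on_def axis_eq_axis)
  have Basis: "Basis = (\<lambda>(i, b). axis i b :: 'a ^ 'p) ` (UNIV \<times> Basis)"
    by (auto simp: Basis_vec_def)
  have "emeasure (distr (Pi\<^sub>M UNIV (\<lambda>_::'p. lborel)) borel vec_lambda) (box l u)
      = emeasure (Pi\<^sub>M UNIV (\<lambda>_::'p. lborel)) (Pi\<^sub>E UNIV (\<lambda>i. box (l $ i) (u $ i)))"
  proof (subst emeasure_distr[OF vec_lambda_measurable])
    have "vec_lambda f \<in> box l u \<longleftrightarrow> (\<forall>i. f i \<in> box (l $ i) (u $ i))" for f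
      by (auto simp: mem_box Basis_vec_def inner_axis)
    then have "vec_lambda -` box l u \<inter> space (Pi\<^sub>M UNIV (\<lambda>_::'p. lborel)) =
        Pi\<^sub>E UNIV (\<lambda>i. box (l $ i) (u $ i))"
      unfolding space_PiM PiE_UNIV_domain by (intro set_eqI) (simp add: Pi_iff)
    then show "emeasure (Pi\<^sub>M UNIV (\<lambda>_::'p. lborel))
        (vec_lambda -` box l u \<inter> space (Pi\<^sub>M UNIV (\<lambda>_::'p. lborel))) =
        emeasure (Pi\<^sub>M UNIV (\<lambda>_::'p. lborel)) (Pi\<^sub>E UNIV (\<lambda>i. box (l $ i) (u $ i)))"
      by simp
  qed simp
  also have "\<dots> = (\<Prod>i\<in>UNIV. emeasure lborel (box (l $ i) (u $ i)))"
    by (rule emeasure_PiM) auto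
  also have "\<dots> = (\<Prod>i\<in>UNIV. ennreal (\<Prod>b\<in>Basis. (u $ i - l $ i) \<bullet> b))"
    using le' by (intro prod.cong refl emeasure_lborel_box) auto
  also have "\<dots> = ennreal (\<Prod>i\<in>UNIV. \<Prod>b\<in>Basis. (u $ i - l $ i) \<bullet> b)"
    using le' by (intro prod_ennreal prod_nonneg) (auto simp: inner_diff_left)
  also have "(\<Prod>i\<in>UNIV. \<Prod>b\<in>Basis. (u $ i - l $ i) \<bullet> b) = (\<Prod>b\<in>Basis. (u - l) \<bullet> b)"
    by (subst Basis, subst prod.reindex[OF inj])
      (simp add: prod.cartesian_product case_prod_unfold inner_axis)
  finally show "emeasure (distr (Pi\<^sub>M UNIV (\<lambda>_::'p. lborel)) borel vec_lambda) (box l u)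
      = ennreal (\<Prod>b\<in>Basis. (u - l) \<bullet> b)" .
qed simp

lemma nn_integral_vec_prod:
  fixes F :: "'p::finite \<Rightarrow> 'a::euclidean_space \<Rightarrow> ennreal"
  assumes [measurable]: "\<And>i. F i \<in> borel_measurable borel"
  shows "(\<integral>\<^sup>+y. (\<Prod>i\<in>UNIV. F i (y $ i)) \<partial>lborel) = (\<Prod>i\<in>UNIV. \<integral>\<^sup>+x. F i x \<partial>lborel)"
proof -
  interpret product_sigma_finite "\<lambda>_::'p. lborel :: 'a measure" ..
  have [measurable]: "(\<lambda>y::'a^'p. y $ i) \<in> borel_measurable borel" for i
    by (intro borel_measurable_continuous_onI continuous_intros)
  have "(\<integral>\<^sup>+y. (\<Prod>i\<in>UNIV. F i (y $ i)) \<partial>lborel) =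
      (\<integral>\<^sup>+f. (\<Prod>i\<in>UNIV. F i (f i)) \<partial>Pi\<^sub>M UNIV (\<lambda>_::'p. lborel))"
    by (subst lborel_vec, subst nn_integral_distr[OF vec_lambda_measurable]) auto
  also have "\<dots> = (\<Prod>i\<in>UNIV. \<integral>\<^sup>+x. F i x \<partial>lborel)"
    by (rule product_nn_integral_prod) auto
  finally show ?thesis .
qed

lemma nn_integral_lborel_affine:
  fixes f :: "'a::euclidean_space \<Rightarrow> ennreal"
  assumes [measurable]: "f \<in> borel_measurable borel" and "0 < c"
  shows "(\<integral>\<^sup>+x. f (v + c *\<^sub>R x) \<partial>lborel) = ennreal (1 / c ^ DIM('a)) * (\<integral>\<^sup>+x. f x \<partial>lborel)"
proof -
  have "(\<integral>\<^sup>+x. f x \<partial>lborel) = ennreal (c ^ DIM('a)) * (\<integral>\<^sup>+x. f (v + c *\<^sub>R x) \<partial>lborel)"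
    using \<open>0 < c\<close> by (subst lborel_affine[of c v])
      (auto simp: nn_integral_density nn_integral_distr nn_integral_cmult)
  then show ?thesis
    using \<open>0 < c\<close> by (simp add: mult.assoc[symmetric] ennreal_mult[symmetric])
qed

lemma nn_integral_shift:
  fixes f :: "'a::euclidean_space \<Rightarrow> ennreal"
  assumes "f \<in> borel_measurable borel"
  shows "(\<integral>\<^sup>+w. f (q + w) \<partial>lborel) = (\<integral>\<^sup>+w. f w \<partial>lborel)"
  using nn_integral_lborel_affine[OF assms, of 1 q] by simp

lemma emeasure_compact: "compact S \<Longrightarrow> emeasure lborel S = ennreal (measure lebesgue S)"
  for S :: "'a::euclidean_space set"
  by (metis borel_compact emeasure_eq_ennreal_measure emeasure_compact_finite infinity_ennreal_def
      less_irrefl measure_completion sets_lborel)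

text \<open>The nonnegative difference has integral zero, finiteness permitting the subtraction. It
  is applied over the base point \<open>y\<close> and again inside a single fibre.\<close>

lemma AE_eq_of_nn_integral_eq:
  assumes [measurable]: "f \<in> borel_measurable M" "g \<in> borel_measurable M"
    and le: "\<And>x. f x \<le> g x"
    and eq: "(\<integral>\<^sup>+x. f x \<partial>M) = (\<integral>\<^sup>+x. g x \<partial>M)" and fin: "(\<integral>\<^sup>+x. f x \<partial>M) \<noteq> \<infinity>"
  shows "AE x in M. g x = f x"
proof -
  have "(\<integral>\<^sup>+x. g x - f x \<partial>M) = 0"
    using fin le by (subst nn_integral_diff) (auto simp: eq)
  then have "AE x in M. g x - f x = 0"
    by (subst (asm) nn_integral_0_iff_AE) auto
  then show ?thesis
    by eventually_elim (metis antisym le ennreal_minus_eq_0)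
qed

lemma AE_lborel_affine_notin:
  fixes F :: "'a::euclidean_space set"
  assumes "negligible F" "closed F" "0 < c"
  shows "AE w in lborel. v + c *\<^sub>R w \<notin> F"
proof -
  have [measurable]: "F \<in> sets borel" using assms by (intro borel_closed)
  have "emeasure lborel F = 0"
    using assms(1) \<open>F \<in> sets borel\<close> by (simp add: negligible_iff_null_sets null_sets_def emeasure_completion)
  then have "(\<integral>\<^sup>+w. indicator F (v + c *\<^sub>R w) \<partial>lborel) = 0"
    using nn_integral_lborel_affine[of "indicator F" c v] assms(3) by simp
  then have "AE w in lborel. indicator F (v + c *\<^sub>R w) = (0::ennreal)"
    by (subst (asm) nn_integral_0_iff_AE) auto
  then show ?thesis by eventually_elim (simp add: indicator_def split: if_splits)
qed

lemma AE_lborel_dense: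
  fixes U :: "'a::euclidean_space set"
  assumes ae: "AE x in lborel. P x" and U: "open U" "U \<noteq> {}"
  obtains x where "x \<in> U" "P x"
proof (rule ccontr)
  assume "\<not> thesis"
  with that have sub: "U \<subseteq> {x. \<not> P x}" by blast
  have "AE x in lebesgue. x \<notin> U"
    using AE_completion[OF ae] by eventually_elim (use sub in blast)
  then have "negligible U" by (simp add: negligible_iff_null_sets AE_iff_null_sets U lborelD)
  with U show False using open_not_negligible by blast
qed

text \<open>Nonempty open sets are not negligible, so the good points are dense. Such sequences
  carry almost-everywhere facts to every point by continuity, semicontinuity or closedness.\<close>

lemma AE_lborel_sequence:
  fixes x :: "'a::euclidean_space"
  assumes "AE x in lborel. P x" "open U" "x \<in> U"
  obtains X where "\<And>k::nat. X k \<in> U" "\<And>k. P (X k)" "X \<longlonglongrightarrow> x"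
proof -
  have "\<exists>z. z \<in> U \<and> P z \<and> dist z x < inverse (real (Suc k))" for k
  proof -
    obtain z where "z \<in> U \<inter> ball x (inverse (real (Suc k)))" "P z"
      using AE_lborel_dense[OF assms(1), of "U \<inter> ball x (inverse (real (Suc k)))"] assms(2,3)
      by (metis IntI centre_in_ball emptyE inverse_positive_iff_positive of_nat_0_less_iff open_Int
          open_ball zero_less_Suc)
    then show ?thesis by (auto simp: dist_commute)
  qed
  then obtain X where X: "X k \<in> U" "P (X k)" "dist (X k) x < inverse (real (Suc k))" for k
    by metis
  have "X \<longlonglongrightarrow> x"
    unfolding tendsto_dist_iff[of X]
    by (rule tendsto_sandwich[OF _ _ tendsto_const LIMSEQ_inverse_real_of_nat])
      (auto intro!: always_eventually less_imp_le X(3) simp del: of_nat_Suc)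
  with X(1,2) show ?thesis using that by blast
qed

section \<open>The volume inequality\<close>

lemma prod_option: "(\<Prod>l\<in>UNIV. f l) = f None * (\<Prod>i\<in>UNIV. f (Some i))"
  for f :: "'p::finite option \<Rightarrow> 'a::comm_monoid_mult"
  by (simp add: UNIV_option_conv prod.reindex)

lemma diag_nth [simp]: "diag x $ i = x"
  by (simp add: diag_def)

lemma linear_diag: "linear diag"
  by (rule linearI) (simp_all add: vec_eq_iff)

lemma linear_axis: "linear (axis i :: 'a::real_vector \<Rightarrow> 'a ^ 'p)"
  by (rule linearI) (simp_all add: vec_eq_iff axis_def)

lemma bounded_linear_diag: "bounded_linear (diag :: real ^ 'n \<Rightarrow> real ^ 'n ^ 'p)"
  by (intro linear_conv_bounded_linear[THEN iffD1] linear_diag)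

lemma bounded_linear_axis: "bounded_linear (axis i :: real ^ 'n \<Rightarrow> real ^ 'n ^ 'p)"
  by (intro linear_conv_bounded_linear[THEN iffD1] linear_axis)

lemma gauge_body_R_body:
  assumes "gauge_body K"
  shows "gauge_body (R_body t K :: (real ^ 'n ^ 'p::finite) set)"
proof
  interpret gauge_body K by fact
  show "compact (R_body t K :: (real ^ 'n ^ 'p) set)"
    unfolding R_body_def
    by (intro compact_convex_hull compact_Un compact_UN compact_continuous_image comp
        continuous_intros linear_continuous_on bounded_linear_diag bounded_linear_axis) auto
  show "convex (R_body t K :: (real ^ 'n ^ 'p) set)"
    by (simp add: R_body_def)
  have "- (t $ None) *\<^sub>R diag 0 \<in> (R_body t K :: (real ^ 'n ^ 'p) set)"
    unfolding R_body_def using zero_mem by (intro hull_inc) blast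
  moreover have "diag 0 = (0 :: real ^ 'n ^ 'p)"
    using linear_diag by (rule linear_0)
  ultimately show "0 \<in> (R_body t K :: (real ^ 'n ^ 'p) set)" by simp
qed

text \<open>In the coordinates \<open>x\<^sub>0 = w / t\<^sub>0\<close>, \<open>x\<^sub>i = (y\<^sub>i + w) / t\<^sub>i\<close> this is the product of the
  \<open>exp (- N(x\<^sub>l))\<close>. Its fibre over \<open>y\<close> collects the representations
  \<open>y\<^sub>i = t\<^sub>i x\<^sub>i - t\<^sub>0 x\<^sub>0\<close>.\<close>

definition fibre_density ::
    "real ^ 'p::finite option \<Rightarrow> (real ^ 'n) set \<Rightarrow> real ^ 'n ^ 'p \<Rightarrow> real ^ 'n \<Rightarrow> real" where
  "fibre_density t K y w =
     exp_gauge K (w /\<^sub>R t $ None) * (\<Prod>i\<in>UNIV. exp_gauge K ((y $ i + w) /\<^sub>R t $ Some i))"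

locale weighted_body = gauge_body K for K :: "(real ^ 'n) set" +
  fixes t :: "real ^ 'p::finite option"
  assumes t_pos: "\<And>l. 0 < t $ l"
begin

abbreviation R :: "(real ^ 'n ^ 'p) set" where "R \<equiv> R_body t K"

abbreviation rate :: real where "rate \<equiv> \<Sum>l\<in>UNIV. 1 / t $ l"

sublocale R: gauge_body R
  by (rule gauge_body_R_body) unfold_locales

lemma rate_pos: "0 < rate"
  by (intro sum_pos) (auto simp: t_pos)

lemma fibre_density_nonneg: "0 \<le> fibre_density t K y w"
  by (simp add: fibre_density_def prod_nonneg)

lemma fibre_density_joint_measurable:
  "(\<lambda>z. ennreal (fibre_density t K (fst z) (snd z))) \<in> borel_measurable borel"
  unfolding fibre_density_def
  by (intro measurable_compose[OF _ measurable_ennreal] borel_measurable_times borel_measurable_prod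
      measurable_compose[OF borel_measurable_continuous_onI exp_gauge_measurable] continuous_intros)

lemma fibre_density_fibre_measurable [measurable]: "fibre_density t K y \<in> borel_measurable borel"
  unfolding fibre_density_def
  by (intro borel_measurable_times borel_measurable_prod
      measurable_compose[OF borel_measurable_continuous_onI exp_gauge_measurable] continuous_intros)

lemma fibre_density_pair_measurable:
  "case_prod (\<lambda>y w. ennreal (fibre_density t K y w)) \<in> borel_measurable (lborel \<Otimes>\<^sub>M lborel)"
  using fibre_density_joint_measurable by (simp add: lborel_prod split_beta')

text \<open>Tonelli with \<open>w\<close> outermost: for fixed \<open>w\<close> the density is a
  product over the factors of \<open>y\<close>, and each dilated integral contributes one power
  \<open>(t $ l) ^ CARD('n)\<close>.\<close>

lemma total_fibre_density:
  "(\<integral>\<^sup>+y. \<integral>\<^sup>+w. ennreal (fibre_density t K y w) \<partial>lborel \<partial>lborel) =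
     ennreal ((\<Prod>l\<in>UNIV. t $ l) ^ CARD('n)) *
       (\<integral>\<^sup>+x. ennreal (exp_gauge K x) \<partial>lborel) ^ Suc CARD('p)"
proof -
  let ?G = "\<lambda>x. ennreal (exp_gauge K x)"
  let ?I = "\<integral>\<^sup>+x. ?G x \<partial>lborel"
  have dil: "(\<integral>\<^sup>+x. ?G ((x + v) /\<^sub>R t $ l) \<partial>lborel) = ennreal ((t $ l) ^ CARD('n)) * ?I" for v l
  proof -
    have "(\<integral>\<^sup>+x. ?G ((x + v) /\<^sub>R t $ l) \<partial>lborel) =
        (\<integral>\<^sup>+x. ?G (v /\<^sub>R t $ l + inverse (t $ l) *\<^sub>R x) \<partial>lborel)"
      by (simp add: scaleR_add_right add.commute)
    also have "\<dots> = ennreal (1 / inverse (t $ l) ^ CARD('n)) * ?I"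
      using t_pos by (subst nn_integral_lborel_affine) auto
    finally show ?thesis by (simp add: power_inverse divide_inverse)
  qed
  have "(\<integral>\<^sup>+y. \<integral>\<^sup>+w. ennreal (fibre_density t K y w) \<partial>lborel \<partial>lborel) =
      (\<integral>\<^sup>+w. \<integral>\<^sup>+y. ennreal (fibre_density t K y w) \<partial>lborel \<partial>lborel)"
    by (rule lborel_pair.Fubini'[symmetric]) (rule fibre_density_pair_measurable)
  also have "\<dots> = (\<integral>\<^sup>+w. ?G ((w + 0) /\<^sub>R t $ None) *
      (\<integral>\<^sup>+y. (\<Prod>i\<in>UNIV. ?G ((y $ i + w) /\<^sub>R t $ Some i)) \<partial>lborel) \<partial>lborel)"
  proof (intro nn_integral_cong)
    fix w :: "real ^ 'n"
    have "(\<lambda>y::real ^ 'n ^ 'p. (\<Prod>i\<in>UNIV. ?G ((y $ i + w) /\<^sub>R t $ Some i))) \<in> borel_measurable borel"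
      by (intro borel_measurable_prod_ennreal measurable_compose[OF _ measurable_ennreal]
          measurable_compose[OF borel_measurable_continuous_onI exp_gauge_measurable] continuous_intros)
    then show "(\<integral>\<^sup>+y. ennreal (fibre_density t K y w) \<partial>lborel) = ?G ((w + 0) /\<^sub>R t $ None) *
        (\<integral>\<^sup>+y. (\<Prod>i\<in>UNIV. ?G ((y $ i + w) /\<^sub>R t $ Some i)) \<partial>lborel)"
      by (subst nn_integral_cmult[symmetric])
        (simp_all add: fibre_density_def ennreal_mult prod_nonneg prod_ennreal)
  qed
  also have "\<dots> = (\<integral>\<^sup>+w. ?G ((w + 0) /\<^sub>R t $ None) *
      (\<Prod>i\<in>UNIV. ennreal ((t $ Some i) ^ CARD('n)) * ?I) \<partial>lborel)"
  proof (intro nn_integral_cong arg_cong2[where f = "(*)"] refl)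
    fix w :: "real ^ 'n"
    have "(\<lambda>x. ?G ((x + w) /\<^sub>R t $ Some i)) \<in> borel_measurable borel" for i
      by (intro measurable_compose[OF _ measurable_ennreal]
          measurable_compose[OF borel_measurable_continuous_onI exp_gauge_measurable] continuous_intros)
    then show "(\<integral>\<^sup>+y. (\<Prod>i\<in>UNIV. ?G ((y $ i + w) /\<^sub>R t $ Some i)) \<partial>lborel) =
        (\<Prod>i\<in>UNIV. ennreal ((t $ Some i) ^ CARD('n)) * ?I)"
      by (subst nn_integral_vec_prod[where F = "\<lambda>i x. ?G ((x + w) /\<^sub>R t $ Some i)"]) (simp_all add: dil)
  qed
  also have "\<dots> = (\<integral>\<^sup>+w. ?G ((w + 0) /\<^sub>R t $ None) \<partial>lborel) *
      (\<Prod>i\<in>UNIV. ennreal ((t $ Some i) ^ CARD('n)) * ?I)"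
    by (intro nn_integral_multc) measurable
  also have "\<dots> = (\<Prod>l\<in>UNIV. ennreal ((t $ l) ^ CARD('n)) * ?I)"
    by (simp only: dil prod_option)
  also have "\<dots> = ennreal ((\<Prod>l\<in>UNIV. t $ l) ^ CARD('n)) * ?I ^ Suc CARD('p)"
    using t_pos by (simp add: prod.distrib prod_ennreal less_imp_le prod_power_distrib card_UNIV_option)
  finally show ?thesis .
qed

text \<open>The points with a representation of total gauge at most one form a convex set by
  subadditivity. It contains the generators, which need at most one nonzero entry, hence all of
  \<open>R\<close>; scaling by \<open>s\<close> gives the rest.\<close>

lemma R_decompose:
  assumes "y \<in> (*\<^sub>R) s ` R" "0 \<le> s"
  obtains x where "\<And>l. x l \<in> cone hull K" "(\<Sum>l\<in>UNIV. minkowski K (x l)) \<le> s"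
    "\<And>i. y $ i = t $ Some i *\<^sub>R x (Some i) - t $ None *\<^sub>R x None"
proof -
  let ?P = "\<lambda>y x. (\<forall>l. x l \<in> cone hull K) \<and>
    (\<forall>i. y $ i = t $ Some i *\<^sub>R x (Some i) - t $ None *\<^sub>R x None)"
  let ?T = "{y::real ^ 'n ^ 'p. \<exists>x. ?P y x \<and> (\<Sum>l\<in>UNIV. minkowski K (x l)) \<le> 1}"
  have "convex ?T"
  proof (rule convexI, clarify)
    fix y x y' x' and u v :: real
    assume uv: "0 \<le> u" "0 \<le> v" "u + v = 1"
      and x: "\<forall>l. x l \<in> cone hull K" "(\<Sum>l\<in>UNIV. minkowski K (x l)) \<le> 1"
        "\<forall>i. y $ i = t $ Some i *\<^sub>R x (Some i) - t $ None *\<^sub>R x None"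
      and x': "\<forall>l. x' l \<in> cone hull K" "(\<Sum>l\<in>UNIV. minkowski K (x' l)) \<le> 1"
        "\<forall>i. y' $ i = t $ Some i *\<^sub>R x' (Some i) - t $ None *\<^sub>R x' None"
    let ?x = "\<lambda>l. u *\<^sub>R x l + v *\<^sub>R x' l"
    have "(\<Sum>l\<in>UNIV. minkowski K (?x l)) \<le> (\<Sum>l\<in>UNIV. u * minkowski K (x l) + v * minkowski K (x' l))"
      using uv x x' by (intro sum_mono order_trans[OF minkowski_add])
        (auto simp: minkowski_scale scale_cone)
    also have "\<dots> = u * (\<Sum>l\<in>UNIV. minkowski K (x l)) + v * (\<Sum>l\<in>UNIV. minkowski K (x' l))"
      by (simp add: sum.distrib sum_distrib_left)
    also have "\<dots> \<le> 1" using uv x x' by (intro convex_bound_le) auto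
    finally have "(\<Sum>l\<in>UNIV. minkowski K (?x l)) \<le> 1" .
    moreover have "?P (u *\<^sub>R y + v *\<^sub>R y') ?x"
    proof (intro conjI allI)
      show "?x l \<in> cone hull K" for l using uv x x' by (simp add: add_cone scale_cone)
      show "(u *\<^sub>R y + v *\<^sub>R y') $ i = t $ Some i *\<^sub>R ?x (Some i) - t $ None *\<^sub>R ?x None" for i
        by (simp add: x(3)[rule_format] x'(3)[rule_format] algebra_simps)
    qed
    ultimately show "\<exists>x. ?P (u *\<^sub>R y + v *\<^sub>R y') x \<and> (\<Sum>l\<in>UNIV. minkowski K (x l)) \<le> 1"
      by (intro exI[of _ ?x]) blast
  qed
  have single: "(\<Sum>l\<in>UNIV. minkowski K (if l = m then k else 0)) \<le> 1" if "k \<in> K" for k and m :: "'p option"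
    using that mem_iff[of k] by (simp add: if_distrib[of "minkowski K"] cong: if_cong)
  have "(\<lambda>x. (- (t $ None)) *\<^sub>R diag x) ` K \<union> (\<Union>i. (\<lambda>x. (t $ Some i) *\<^sub>R axis i x) ` K) \<subseteq> ?T"
  proof safe
    fix k assume k: "k \<in> K"
    then have "?P (- (t $ None) *\<^sub>R diag k) (\<lambda>l. if l = None then k else 0)"
      using mem_iff[of k] by auto
    with single[OF k, of "None"] show "\<exists>x. ?P (- (t $ None) *\<^sub>R diag k) x \<and> (\<Sum>l\<in>UNIV. minkowski K (x l)) \<le> 1"
      by (intro exI[of _ "\<lambda>l. if l = None then k else 0"]) blast
  next
    fix i k assume k: "k \<in> K"
    then have "?P (t $ Some i *\<^sub>R axis i k) (\<lambda>l. if l = Some i then k else 0)"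
      using mem_iff[of k] by (auto simp: axis_def)
    with single[OF k, of "Some i"] show "\<exists>x. ?P (t $ Some i *\<^sub>R axis i k) x \<and> (\<Sum>l\<in>UNIV. minkowski K (x l)) \<le> 1"
      by (intro exI[of _ "\<lambda>l. if l = Some i then k else 0"]) blast
  qed
  from hull_minimal[where S = convex, OF this \<open>convex ?T\<close>] have "R \<subseteq> ?T"
    by (simp add: R_body_def)
  moreover obtain r where r: "r \<in> R" "y = s *\<^sub>R r" using assms by auto
  ultimately obtain x where x: "?P r x" "(\<Sum>l\<in>UNIV. minkowski K (x l)) \<le> 1" by blast
  show ?thesis
  proof (rule that[of "\<lambda>l. s *\<^sub>R x l"])
    show "(\<Sum>l\<in>UNIV. minkowski K (s *\<^sub>R x l)) \<le> s"
      using x assms(2) mult_left_mono[OF x(2) assms(2)]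
      by (simp add: minkowski_scale sum_distrib_left[symmetric])
    show "s *\<^sub>R x l \<in> cone hull K" for l using x assms(2) by (simp add: scale_cone)
    have ri: "r $ i = t $ Some i *\<^sub>R x (Some i) - t $ None *\<^sub>R x None" for i using x by blast
    show "y $ i = t $ Some i *\<^sub>R s *\<^sub>R x (Some i) - t $ None *\<^sub>R s *\<^sub>R x None" for i
      unfolding r(2) vector_scaleR_component ri by (simp add: algebra_simps)
  qed
qed

lemma prod_exp_gauge:
  fixes x :: "'p option \<Rightarrow> real ^ 'n"
  assumes "\<And>l. x l \<in> cone hull K"
  shows "(\<Prod>l\<in>UNIV. exp_gauge K (x l)) = exp (- (\<Sum>l\<in>UNIV. minkowski K (x l)))"
  using assms by (simp add: exp_gauge_def exp_sum flip: sum_negf)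

lemma exp_gauge_rate: "(\<Prod>l\<in>UNIV. exp_gauge K (w /\<^sub>R t $ l)) = exp_gauge K (rate *\<^sub>R w)"
proof (cases "w \<in> cone hull K")
  case True
  have "(\<Prod>l\<in>UNIV. exp_gauge K (w /\<^sub>R t $ l)) = exp (- (\<Sum>l\<in>UNIV. minkowski K (w /\<^sub>R t $ l)))"
    using True t_pos by (intro prod_exp_gauge scale_cone) (auto simp: less_imp_le)
  also have "(\<Sum>l\<in>UNIV. minkowski K (w /\<^sub>R t $ l)) = rate * minkowski K w"
    using True t_pos by (simp add: minkowski_scale less_imp_le sum_distrib_right divide_inverse)
  finally show ?thesis
    using True rate_pos by (simp add: exp_gauge_def scale_cone_iff minkowski_scale)
next
  case False
  then have "exp_gauge K (w /\<^sub>R t $ None) = 0" "exp_gauge K (rate *\<^sub>R w) = 0"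
    using t_pos[of None] rate_pos by (auto simp: exp_gauge_def scale_cone_iff)
  then show ?thesis by (simp add: prod_option)
qed

text \<open>Centring the fibre at \<open>t $ None *\<^sub>R x None\<close> makes all coordinates
  symmetric, the index \<open>None\<close> included.\<close>

lemma fibre_density_shift:
  assumes y: "\<And>i. y $ i = t $ Some i *\<^sub>R x (Some i) - t $ None *\<^sub>R x None"
  shows "fibre_density t K y (t $ None *\<^sub>R x None + w) = (\<Prod>l\<in>UNIV. exp_gauge K (x l + w /\<^sub>R t $ l))"
proof -
  have "t $ l \<noteq> 0" for l using t_pos[of l] by simp
  then show ?thesis by (simp add: fibre_density_def prod_option y scaleR_add_right)
qed

text \<open>By \<open>exp_gauge_add\<close> each factor splits into a part from \<open>x l\<close>
  and a part from \<open>w /\<^sub>R t $ l\<close>. The representation \<open>x\<close> is returned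
  as well, because the equality case examines it again.\<close>

lemma fibre_density_ge:
  assumes y: "y \<in> cone hull R"
  obtains x where "\<And>l. x l \<in> cone hull K" "(\<Sum>l\<in>UNIV. minkowski K (x l)) \<le> minkowski R y"
    "\<And>i. y $ i = t $ Some i *\<^sub>R x (Some i) - t $ None *\<^sub>R x None"
    "\<And>w. exp_gauge R y * exp_gauge K (rate *\<^sub>R w) \<le> fibre_density t K y (t $ None *\<^sub>R x None + w)"
proof -
  obtain x where x: "\<And>l. x l \<in> cone hull K" "(\<Sum>l\<in>UNIV. minkowski K (x l)) \<le> minkowski R y"
      "\<And>i. y $ i = t $ Some i *\<^sub>R x (Some i) - t $ None *\<^sub>R x None"
    using R_decompose[OF R.minkowski_attained R.minkowski_nonneg] y by metis
  have "exp_gauge R y * exp_gauge K (rate *\<^sub>R w) \<le> fibre_density t K y (t $ None *\<^sub>R x None + w)" for w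
  proof -
    have "exp_gauge R y * exp_gauge K (rate *\<^sub>R w) \<le>
        (\<Prod>l\<in>UNIV. exp_gauge K (x l)) * (\<Prod>l\<in>UNIV. exp_gauge K (w /\<^sub>R t $ l))"
      using x y unfolding exp_gauge_rate
      by (intro mult_right_mono) (simp_all add: prod_exp_gauge exp_gauge_def[of R])
    also have "\<dots> \<le> (\<Prod>l\<in>UNIV. exp_gauge K (x l + w /\<^sub>R t $ l))"
      unfolding prod.distrib[symmetric] by (intro prod_mono conjI exp_gauge_add) simp
    finally show ?thesis by (simp add: fibre_density_shift[OF x(3)])
  qed
  with x show ?thesis using that by blast
qed

lemma nn_integral_exp_gauge_rate:
  "(\<integral>\<^sup>+w. ennreal (exp_gauge K (rate *\<^sub>R w)) \<partial>lborel) =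
     ennreal (1 / rate ^ CARD('n)) * (\<integral>\<^sup>+x. ennreal (exp_gauge K x) \<partial>lborel)"
  using nn_integral_lborel_affine[of "\<lambda>x. ennreal (exp_gauge K x)" rate 0] rate_pos by simp

lemma fibre_integral_ge:
  "ennreal (exp_gauge R y) * (\<integral>\<^sup>+w. ennreal (exp_gauge K (rate *\<^sub>R w)) \<partial>lborel)
     \<le> (\<integral>\<^sup>+w. ennreal (fibre_density t K y w) \<partial>lborel)"
proof (cases "y \<in> cone hull R")
  case True
  then obtain q where q: "\<And>w. exp_gauge R y * exp_gauge K (rate *\<^sub>R w) \<le> fibre_density t K y (q + w)"
    using fibre_density_ge[OF True] by metis
  have "ennreal (exp_gauge R y) * (\<integral>\<^sup>+w. ennreal (exp_gauge K (rate *\<^sub>R w)) \<partial>lborel) =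
      (\<integral>\<^sup>+w. ennreal (exp_gauge R y * exp_gauge K (rate *\<^sub>R w)) \<partial>lborel)"
    by (subst nn_integral_cmult[symmetric]) (auto simp: ennreal_mult)
  also have "\<dots> \<le> (\<integral>\<^sup>+w. ennreal (fibre_density t K y (q + w)) \<partial>lborel)"
    by (intro nn_integral_mono ennreal_leI q)
  also have "\<dots> = (\<integral>\<^sup>+w. ennreal (fibre_density t K y w) \<partial>lborel)"
    by (rule nn_integral_shift[of "\<lambda>w. ennreal (fibre_density t K y w)"]) measurable
  finally show ?thesis .
qed (simp add: exp_gauge_def)

lemma total_eq:
  "(\<integral>\<^sup>+y. \<integral>\<^sup>+w. ennreal (fibre_density t K y w) \<partial>lborel \<partial>lborel) =
     ennreal ((\<Prod>l\<in>UNIV. t $ l) ^ CARD('n) * (fact CARD('n) * measure lebesgue K) ^ Suc CARD('p))"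
  unfolding total_fibre_density nn_integral_exp_gauge emeasure_compact[OF comp]
  using t_pos by (subst ennreal_mult)
    (auto simp: prod_nonneg less_imp_le ennreal_mult ennreal_power[symmetric] simp flip: ennreal_fact)

lemma lower_eq:
  "(\<integral>\<^sup>+y. ennreal (exp_gauge R y) * (\<integral>\<^sup>+w. ennreal (exp_gauge K (rate *\<^sub>R w)) \<partial>lborel) \<partial>lborel) =
     ennreal (fact (CARD('n) * CARD('p)) * measure lebesgue R *
       (fact CARD('n) * measure lebesgue K / rate ^ CARD('n)))"
proof -
  have "(\<integral>\<^sup>+y. ennreal (exp_gauge R y) * (\<integral>\<^sup>+w. ennreal (exp_gauge K (rate *\<^sub>R w)) \<partial>lborel) \<partial>lborel) =
      ennreal (fact (CARD('n) * CARD('p))) * ennreal (measure lebesgue R) *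
        (ennreal (1 / rate ^ CARD('n)) * (ennreal (fact CARD('n)) * ennreal (measure lebesgue K)))"
    unfolding nn_integral_exp_gauge_rate nn_integral_exp_gauge emeasure_compact[OF comp]
    by (subst nn_integral_multc)
      (simp_all add: R.nn_integral_exp_gauge emeasure_compact R.comp mult.commute flip: ennreal_fact)
  then show ?thesis
    using rate_pos by (simp add: mult.commute mult.left_commute flip: ennreal_mult)
qed

end

section \<open>The multinomial form of the bound\<close>

definition supported_indices :: "'b set \<Rightarrow> nat \<Rightarrow> ('b \<Rightarrow> nat) set" where
  "supported_indices A n = {j. (\<forall>l. l \<notin> A \<longrightarrow> j l = 0) \<and> (\<Sum>l\<in>A. j l) = n}"

lemma finite_supported_indices:
  assumes "finite A"
  shows "finite (supported_indices A n)"
proof (rule finite_subset)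
  show "supported_indices A n \<subseteq> {j. \<forall>l. (l \<in> A \<longrightarrow> j l \<in> {..n}) \<and> (l \<notin> A \<longrightarrow> j l = 0)}"
    using member_le_sum[OF _ _ assms] by (auto simp: supported_indices_def)
  show "finite {j. \<forall>l. (l \<in> A \<longrightarrow> j l \<in> {..n}) \<and> (l \<notin> A \<longrightarrow> j l = (0::nat))}"
    using assms by (intro finite_set_of_finite_funs) auto
qed

text \<open>Induction on \<open>A\<close>, the binomial theorem splitting off one index.
  Multi-indices vanish off \<open>A\<close>, so they form a finite set of functions on the whole
  type and extend by function update.\<close>

theorem multinomial_theorem:
  fixes x :: "'b \<Rightarrow> real"
  assumes "finite A"
  shows "(\<Sum>l\<in>A. x l) ^ n =
    (\<Sum>j\<in>supported_indices A n. fact n / (\<Prod>l\<in>A. fact (j l)) * (\<Prod>l\<in>A. x l ^ j l))"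
  using assms
proof (induction A arbitrary: n)
  case empty
  have "supported_indices ({} :: 'b set) n = (if n = 0 then {\<lambda>_. 0} else {})"
    by (auto simp: supported_indices_def)
  then show ?case by (cases n) simp_all
next
  case (insert a A)
  let ?c = "\<lambda>A n j. fact n / (\<Prod>l\<in>A. fact (j l)) * (\<Prod>l\<in>A. x l ^ j l)"
  have upd: "(\<Sum>l\<in>A. (j(a := k)) l) = (\<Sum>l\<in>A. j l)"
      "(\<Prod>l\<in>A. fact ((j(a := k)) l) :: real) = (\<Prod>l\<in>A. fact (j l))"
      "(\<Prod>l\<in>A. x l ^ (j(a := k)) l) = (\<Prod>l\<in>A. x l ^ j l)" for j k
    using insert.hyps by (auto intro!: sum.cong prod.cong)
  have "(\<Sum>l\<in>insert a A. x l) ^ n = (x a + (\<Sum>l\<in>A. x l)) ^ n"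
    using insert.hyps by simp
  also have "\<dots> = (\<Sum>k\<le>n. of_nat (n choose k) * x a ^ k * (\<Sum>l\<in>A. x l) ^ (n - k))"
    by (rule binomial_ring)
  also have "\<dots> = (\<Sum>k\<le>n. \<Sum>j\<in>supported_indices A (n - k). ?c (insert a A) n (j(a := k)))"
    using insert.hyps
    by (intro sum.cong refl)
      (simp add: insert.IH sum_distrib_left upd binomial_fact divide_simps del: fun_upd_apply
        add: fun_upd_same)
  also have "\<dots> = (\<Sum>(k, j)\<in>(SIGMA k:{..n}. supported_indices A (n - k)). ?c (insert a A) n (j(a := k)))"
    using insert.hyps by (intro sum.Sigma) (auto simp: finite_supported_indices)
  also have "\<dots> = (\<Sum>j\<in>supported_indices (insert a A) n. ?c (insert a A) n j)"
    using insert.hyps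
    by (intro sum.reindex_bij_witness[where i = "\<lambda>j. (j a, j(a := 0))" and j = "\<lambda>(k, j). j(a := k)"])
      (auto simp: supported_indices_def upd fun_upd_idem simp del: fun_upd_apply, auto)
  finally show ?case .
qed

lemma multi_indices_eq: "multi_indices n = supported_indices UNIV n"
  by (simp add: multi_indices_def supported_indices_def)

text \<open>Each \<open>t ^ (n - j)\<close> is \<open>t ^ n * (1 / t) ^ j\<close>, so once the
  \<open>n\<close>-th power of the product of the weights is extracted, the multinomial expansion of
  the reciprocal sum remains.\<close>

lemma sum_monomial_compl:
  fixes t :: "real ^ 'p::finite option"
  assumes "\<And>l. t $ l \<noteq> 0"
  shows "(\<Sum>j\<in>multi_indices n. multinomial n j * monomial_compl n t j) =
    ((\<Prod>l\<in>UNIV. t $ l) * (\<Sum>l\<in>UNIV. 1 / t $ l)) ^ n"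
proof -
  have "monomial_compl n t j = (\<Prod>l\<in>UNIV. t $ l) ^ n * (\<Prod>l\<in>UNIV. (1 / t $ l) ^ j l)"
    if "j \<in> multi_indices n" for j
  proof -
    have "j l \<le> n" for l
      using that member_le_sum[of l UNIV j] by (simp add: multi_indices_def)
    then show ?thesis
      using assms unfolding monomial_compl_def prod_power_distrib prod.distrib[symmetric]
      by (intro prod.cong refl) (simp add: power_diff power_inverse divide_inverse)
  qed
  then have "(\<Sum>j\<in>multi_indices n. multinomial n j * monomial_compl n t j) =
      (\<Sum>j\<in>multi_indices n. (\<Prod>l\<in>UNIV. t $ l) ^ n *
        (fact n / (\<Prod>l\<in>UNIV. fact (j l)) * (\<Prod>l\<in>UNIV. (1 / t $ l) ^ j l)))"
    by (intro sum.cong refl) (simp add: multinomial_def)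
  then show ?thesis
    unfolding power_mult_distrib[of _ "\<Sum>l\<in>UNIV. 1 / t $ l"]
    unfolding multinomial_theorem[OF finite]
      multi_indices_eq sum_distrib_left .
qed

text \<open>\<open>K\<close> is star-shaped about \<open>0\<close>, so
  \<open>t $ l *\<^sub>R k\<close> equals \<open>t' $ l *\<^sub>R k'\<close> for a contraction
  \<open>k'\<close> of \<open>k\<close>: generators of the smaller body are generators of the
  larger.\<close>

lemma R_body_mono:
  fixes t t' :: "real ^ 'p::finite option" and K :: "(real ^ 'n) set"
  assumes K: "convex K" "0 \<in> K" and le: "\<And>l. 0 \<le> t $ l" "\<And>l. t $ l \<le> t' $ l"
  shows "R_body t K \<subseteq> R_body t' K"
proof -
  have scale: "\<exists>k'\<in>K. t $ l *\<^sub>R k = t' $ l *\<^sub>R k'" if "k \<in> K" for k l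
  proof (cases "t' $ l = 0")
    case True
    then have "t $ l = 0" using le[of l] by simp
    with True that show ?thesis by auto
  next
    case False
    then have "0 < t' $ l" using le[of l] by simp
    then have "(t $ l / t' $ l) *\<^sub>R k \<in> K"
      using mem_convex_alt[OF K(1) that K(2), of "t $ l / t' $ l" "1 - t $ l / t' $ l"] le[of l] by simp
    with \<open>0 < t' $ l\<close> show ?thesis by (intro bexI[of _ "(t $ l / t' $ l) *\<^sub>R k"]) auto
  qed
  have d: "a *\<^sub>R diag x = (diag (a *\<^sub>R x) :: real ^ 'n ^ 'p)" "a *\<^sub>R axis i x = (axis i (a *\<^sub>R x) :: real ^ 'n ^ 'p)"
    for a i and x :: "real ^ 'n"
    by (simp_all add: linear_scale linear_diag linear_axis)
  show ?thesis
    unfolding R_body_def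
  proof (rule hull_mono, rule Un_mono, safe)
    fix k assume "k \<in> K"
    then obtain k' where "k' \<in> K" "t $ None *\<^sub>R k = t' $ None *\<^sub>R k'" using scale by blast
    then have "k' \<in> K" "- (t $ None) *\<^sub>R diag k = (- (t' $ None) *\<^sub>R diag k' :: real ^ 'n ^ 'p)"
      by (simp_all only: d scaleR_minus_left)
    then show "- (t $ None) *\<^sub>R diag k \<in> (\<lambda>x. - (t' $ None) *\<^sub>R diag x :: real ^ 'n ^ 'p) ` K" by blast
  next
    fix i k assume "k \<in> K"
    then obtain k' where "k' \<in> K" "t $ Some i *\<^sub>R k = t' $ Some i *\<^sub>R k'" using scale by blast
    then have "t $ Some i *\<^sub>R axis i k = (t' $ Some i *\<^sub>R axis i k' :: real ^ 'n ^ 'p)" by (simp only: d)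
    then show "t $ Some i *\<^sub>R axis i k \<in> (\<Union>i. (\<lambda>x. t' $ Some i *\<^sub>R axis i x :: real ^ 'n ^ 'p) ` K)"
      using \<open>k' \<in> K\<close> by blast
  qed
qed

text \<open>A null convex body lies in a hyperplane, here through \<open>0\<close>, and its normal
  placed in one factor annihilates every generator. This covers the case in which the common factor
  of the two integrals is zero and cannot be cancelled.\<close>

lemma measure_R_body_negligible:
  fixes t :: "real ^ 'p::finite option" and K :: "(real ^ 'n) set"
  assumes "gauge_body K" and null: "measure lebesgue K = 0"
  shows "measure lebesgue (R_body t K :: (real ^ 'n ^ 'p) set) = 0"
proof -
  interpret gauge_body K by fact
  have "negligible K"
    using null comp by (simp add: negligible_iff_measure lmeasurable_compact)
  then have "interior K = {}"
    using negligible_subset[OF _ interior_subset] open_not_negligible open_interior by blast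
  then obtain a b where a: "a \<noteq> 0" and K: "K \<subseteq> {x. a \<bullet> x = b}"
    using empty_interior_subset_hyperplane[OF conv] by metis
  with zero_mem have "b = 0" by auto
  define i0 :: 'p where "i0 = undefined"
  let ?H = "{y::real ^ 'n ^ 'p. axis i0 a \<bullet> y = 0}"
  have "R_body t K \<subseteq> ?H"
    unfolding R_body_def
  proof (rule hull_minimal)
    show "(\<lambda>x. - (t $ None) *\<^sub>R diag x) ` K \<union> (\<Union>i. (\<lambda>x. t $ Some i *\<^sub>R axis i x) ` K) \<subseteq> ?H"
    proof -
      have "(axis i k :: real ^ 'n ^ 'p) $ i0 = (if i0 = i then k else 0)" for i k
        by (simp add: axis_def)
      then show ?thesis using K \<open>b = 0\<close> by (auto simp: inner_axis')
    qed
    show "convex ?H" by (rule convex_hyperplane)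
  qed
  moreover have "axis i0 a \<noteq> 0" using a by (simp add: axis_eq_0_iff)
  ultimately have "negligible (R_body t K :: (real ^ 'n ^ 'p) set)"
    using negligible_subset negligible_hyperplane by blast
  then show ?thesis by (simp add: negligible_iff_measure)
qed

section \<open>The inequality for positive weights and its limit\<close>

context weighted_body
begin

lemma R_bound_eq:
  "R_bound t K = fact CARD('n) ^ CARD('p) / fact (CARD('n) * CARD('p)) *
     ((\<Prod>l\<in>UNIV. t $ l) * rate) ^ CARD('n) * measure lebesgue K ^ CARD('p)"
  using t_pos by (simp add: R_bound_def sum_monomial_compl less_imp_neq[THEN not_sym])

text \<open>The two integrals compared in the proof differ from the volume and its bound by the same
  positive factor.\<close>

lemma R_bound_scaled:
  "(\<Prod>l\<in>UNIV. t $ l) ^ CARD('n) * (fact CARD('n) * measure lebesgue K) ^ Suc CARD('p) =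
     fact (CARD('n) * CARD('p)) * R_bound t K * (fact CARD('n) * measure lebesgue K / rate ^ CARD('n))"
  using rate_pos unfolding R_bound_eq by (simp add: power_mult_distrib field_simps)

lemma measure_R_le: "measure lebesgue R \<le> R_bound t K"
proof (cases "measure lebesgue K = 0")
  case True
  then show ?thesis
    using measure_R_body_negligible[OF gauge_body_axioms, of t] by (simp add: R_bound_def zero_power)
next
  case False
  then have pos: "0 < fact CARD('n) * measure lebesgue K / rate ^ CARD('n)"
    using rate_pos by (simp add: zero_less_measure_iff)
  have "(\<integral>\<^sup>+y. ennreal (exp_gauge R y) * (\<integral>\<^sup>+w. ennreal (exp_gauge K (rate *\<^sub>R w)) \<partial>lborel) \<partial>lborel) \<le>
      (\<integral>\<^sup>+y. \<integral>\<^sup>+w. ennreal (fibre_density t K y w) \<partial>lborel \<partial>lborel)"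
    by (intro nn_integral_mono fibre_integral_ge)
  then have "fact (CARD('n) * CARD('p)) * measure lebesgue R *
      (fact CARD('n) * measure lebesgue K / rate ^ CARD('n)) \<le>
      fact (CARD('n) * CARD('p)) * R_bound t K * (fact CARD('n) * measure lebesgue K / rate ^ CARD('n))"
    unfolding lower_eq total_eq R_bound_scaled[symmetric]
    using t_pos
    by (subst (asm) ennreal_le_iff)
      (auto intro!: mult_nonneg_nonneg zero_le_power prod_nonneg simp: less_imp_le)
  then have "fact (CARD('n) * CARD('p)) * measure lebesgue R \<le> fact (CARD('n) * CARD('p)) * R_bound t K"
    using pos by (simp only: mult_le_cancel_right_pos)
  then show ?thesis by (simp add: mult_le_cancel_left_pos)
qed

end

text \<open>Adding \<open>1 / (k + 1)\<close> to every weight makes all of them positive and only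
  enlarges the body, while \<open>R_bound\<close> is polynomial in the weights and passes to the
  limit.\<close>

lemma measure_R_body_le:
  fixes t :: "real ^ 'p::finite option" and K :: "(real ^ 'n) set"
  assumes "gauge_body K" "\<And>l. 0 \<le> t $ l"
  shows "measure lebesgue (R_body t K :: (real ^ 'n ^ 'p) set) \<le> R_bound t K"
proof (rule LIMSEQ_le_const)
  interpret gauge_body K by fact
  let ?t = "\<lambda>k. (\<chi> l. t $ l + inverse (real (Suc k)))"
  have "?t \<longlonglongrightarrow> t"
    using tendsto_add[OF tendsto_const LIMSEQ_inverse_real_of_nat] by (intro vec_tendstoI) simp
  then show "(\<lambda>k. R_bound (?t k) K) \<longlonglongrightarrow> R_bound t K"
    unfolding R_bound_def monomial_compl_def by (intro tendsto_intros)
  have "measure lebesgue (R_body t K :: (real ^ 'n ^ 'p) set) \<le> R_bound (?t k) K" for k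
  proof -
    interpret weighted_body K "?t k"
      by unfold_locales (use assms(2) in \<open>simp add: add_nonneg_pos\<close>)
    have "measure lebesgue (R_body t K :: (real ^ 'n ^ 'p) set) \<le> measure lebesgue (R_body (?t k) K :: (real ^ 'n ^ 'p) set)"
      using gauge_body.comp[OF gauge_body_R_body[OF assms(1)]]
      by (intro measure_mono_fmeasurable R_body_mono conv zero_mem lmeasurable_compact assms(2))
        (auto intro: lmeasurable_compact fmeasurableD)
    also have "\<dots> \<le> R_bound (?t k) K" by (rule measure_R_le)
    finally show ?thesis .
  qed
  then show "\<exists>N. \<forall>k\<ge>N. measure lebesgue (R_body t K :: (real ^ 'n ^ 'p) set) \<le> R_bound (?t k) K" by blast
qed

section \<open>Equality in the fibres\<close>

context weighted_body
begin

text \<open>Fatou's lemma: the integrands converge for almost every \<open>w\<close>, since each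
  argument of \<open>exp_gauge\<close> is affine in \<open>w\<close> and meets the null frontier of
  the cone only on a null set.\<close>

lemma fibre_integral_liminf:
  assumes Y: "Y \<longlonglongrightarrow> y"
  shows "(\<integral>\<^sup>+w. ennreal (fibre_density t K y w) \<partial>lborel) \<le>
    liminf (\<lambda>k. \<integral>\<^sup>+w. ennreal (fibre_density t K (Y k) w) \<partial>lborel)"
proof -
  let ?F = "frontier (cone hull K)"
  have neg: "AE w in lborel. v + inverse (t $ l) *\<^sub>R w \<notin> ?F" for v l
    using t_pos by (intro AE_lborel_affine_notin negligible_convex_frontier cone_convex) auto
  have "AE w in lborel. inverse (t $ None) *\<^sub>R w \<notin> ?F"
    using neg[of 0] by simp
  moreover have "AE w in lborel. \<forall>i. y $ i /\<^sub>R t $ Some i + inverse (t $ Some i) *\<^sub>R w \<notin> ?F"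
    using neg by (simp add: AE_all_countable)
  ultimately have "AE w in lborel. ennreal (fibre_density t K y w) \<le>
      liminf (\<lambda>k. ennreal (fibre_density t K (Y k) w))"
  proof eventually_elim
    case (elim w)
    have "(\<lambda>k. fibre_density t K (Y k) w) \<longlonglongrightarrow> fibre_density t K y w"
      unfolding fibre_density_def
      using elim Y
      by (intro tendsto_intros isCont_tendsto_compose[OF isCont_exp_gauge]) (auto simp: scaleR_add_right)
    then have "(\<lambda>k. ennreal (fibre_density t K (Y k) w)) \<longlonglongrightarrow> ennreal (fibre_density t K y w)"
      by (rule tendsto_ennrealI)
    from lim_imp_Liminf[OF _ this] show ?case by simp
  qed
  then have "(\<integral>\<^sup>+w. ennreal (fibre_density t K y w) \<partial>lborel) \<le>
      (\<integral>\<^sup>+w. liminf (\<lambda>k. ennreal (fibre_density t K (Y k) w)) \<partial>lborel)"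
    by (rule nn_integral_mono_AE)
  also have "\<dots> \<le> liminf (\<lambda>k. \<integral>\<^sup>+w. ennreal (fibre_density t K (Y k) w) \<partial>lborel)"
    by (intro nn_integral_liminf) measurable
  finally show ?thesis .
qed

lemma rate_integral:
  "(\<integral>\<^sup>+w. ennreal (exp_gauge K (rate *\<^sub>R w)) \<partial>lborel) =
     ennreal (fact CARD('n) * measure lebesgue K / rate ^ CARD('n))"
  unfolding nn_integral_exp_gauge_rate nn_integral_exp_gauge emeasure_compact[OF comp]
  using rate_pos by (simp add: ennreal_mult[symmetric] flip: ennreal_fact)

text \<open>Equality of the integrals gives equality for almost every \<open>y\<close>; lower semicontinuity of the
  fibre integral and upper semicontinuity of \<open>exp_gauge R\<close> give it for every \<open>y\<close>.\<close>

lemma fibre_integral_eq: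
  assumes eq: "measure lebesgue R = R_bound t K"
  shows "(\<integral>\<^sup>+w. ennreal (fibre_density t K y w) \<partial>lborel) =
    ennreal (exp_gauge R y) * (\<integral>\<^sup>+w. ennreal (exp_gauge K (rate *\<^sub>R w)) \<partial>lborel)"
    (is "?F y = ennreal (exp_gauge R y) * ?I")
proof (rule antisym)
  define c where "c = fact CARD('n) * measure lebesgue K / rate ^ CARD('n)"
  have c: "?I = ennreal c" "0 \<le> c"
    using rate_pos by (auto simp: rate_integral c_def)
  have "AE y in lborel. ?F y = ennreal (exp_gauge R y) * ?I"
  proof (rule AE_eq_of_nn_integral_eq)
    show "?F \<in> borel_measurable lborel"
      by (intro lborel.borel_measurable_nn_integral fibre_density_pair_measurable)
    show "(\<integral>\<^sup>+y. ennreal (exp_gauge R y) * ?I \<partial>lborel) = (\<integral>\<^sup>+y. ?F y \<partial>lborel)"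
      unfolding lower_eq total_eq R_bound_scaled eq ..
    show "(\<integral>\<^sup>+y. ennreal (exp_gauge R y) * ?I \<partial>lborel) \<noteq> \<infinity>"
      unfolding lower_eq by simp
  qed (auto intro: fibre_integral_ge)
  then obtain Y where Y: "\<And>k. ?F (Y k) = ennreal (exp_gauge R (Y k)) * ?I" "Y \<longlonglongrightarrow> y"
    using AE_lborel_sequence[of _ UNIV y] by auto
  show "?F y \<le> ennreal (exp_gauge R y) * ?I"
  proof (rule ennreal_le_epsilon)
    fix e :: real assume "0 < e"
    \<comment> \<open>Dividing by \<open>c + 1\<close> rather than \<open>c\<close> gives
      \<open>d * c <= e\<close> without dividing by zero.\<close>
    define d where "d = e / (c + 1)"
    have d: "0 < d" "d * c \<le> e" using \<open>0 < e\<close> c by (auto simp: d_def field_simps)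
    \<comment> \<open>Superlevel sets of \<open>exp_gauge R\<close> are closed, so the
      \<open>Y k\<close> eventually leave the one at height
      \<open>exp_gauge R y + d\<close>.\<close>
    have "eventually (\<lambda>k. Y k \<in> - {x. exp_gauge R y + d \<le> exp_gauge R x}) sequentially"
      using d by (intro topological_tendstoD[OF Y(2)]) (auto simp: R.closed_exp_gauge_ge open_Compl)
    then have "eventually (\<lambda>k. ?F (Y k) \<le> ennreal (exp_gauge R y + d) * ?I) sequentially"
      by eventually_elim (auto simp: Y(1) intro!: mult_right_mono ennreal_leI)
    then have "liminf (\<lambda>k. ?F (Y k)) \<le> liminf (\<lambda>_::nat. ennreal (exp_gauge R y + d) * ?I)"
      by (rule Liminf_mono)
    then have "?F y \<le> ennreal (exp_gauge R y + d) * ?I"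
      using fibre_integral_liminf[OF Y(2)] by (simp add: Liminf_const)
    also have "\<dots> = ennreal (exp_gauge R y * c + d * c)"
      using d c by (simp add: c(1) ennreal_mult'[symmetric] algebra_simps)
    also have "\<dots> \<le> ennreal (exp_gauge R y * c + e)"
      using d by (intro ennreal_leI) simp
    also have "\<dots> = ennreal (exp_gauge R y) * ?I + ennreal e"
      using c \<open>0 < e\<close> by (simp add: ennreal_mult)
    finally show "?F y \<le> ennreal (exp_gauge R y) * ?I + ennreal e" .
  qed
qed (rule fibre_integral_ge)

text \<open>Off the cone of \<open>R\<close> the fibre equality would make the fibre integral
  vanish, but the density is positive on the nonempty open set where \<open>w\<close> and
  \<open>w + u\<close> are both interior to the cone.\<close>

lemma diag_mem_cone:
  assumes eq: "measure lebesgue R = R_bound t K" and int: "interior (cone hull K) \<noteq> {}"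
  shows "diag u \<in> cone hull R"
proof (rule ccontr)
  let ?U = "interior (cone hull K) \<inter> (\<lambda>w. w + u) -` interior (cone hull K)"
  assume "diag u \<notin> cone hull R"
  then have "(\<integral>\<^sup>+w. ennreal (fibre_density t K (diag u) w) \<partial>lborel) = 0"
    by (simp add: fibre_integral_eq[OF eq] exp_gauge_def)
  then have "AE w in lborel. ennreal (fibre_density t K (diag u) w) = 0"
    by (subst (asm) nn_integral_0_iff_AE) auto
  moreover have "open ?U"
    by (intro open_Int open_interior open_vimage continuous_intros)
  moreover obtain w where "w \<in> ?U" using ex_translate_interior[OF int] by blast
  ultimately obtain w where w: "w \<in> ?U" "ennreal (fibre_density t K (diag u) w) = 0"
    using AE_lborel_dense[of _ ?U] by blast
  have "w \<in> cone hull K" "u + w \<in> cone hull K"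
    using w(1) interior_subset[of "cone hull K"] by (auto simp: add.commute)
  then have "0 < fibre_density t K (diag u) w"
    using t_pos unfolding fibre_density_def
    by (auto intro!: mult_pos_pos prod_pos simp: exp_gauge_pos_iff scale_cone_iff)
  with w(2) show False by (simp add: ennreal_eq_0_iff)
qed

text \<open>For \<open>y = (u, \<dots>, u)\<close> the conclusion no longer involves \<open>t\<close>. The point \<open>q\<close> plays the part of
  the supremum of \<open>0\<close> and \<open>- u\<close> for the order defined by the cone.\<close>

lemma diag_fibre_rigid:
  assumes eq: "measure lebesgue R = R_bound t K" and int: "interior (cone hull K) \<noteq> {}"
  obtains q where "q \<in> cone hull K" "q + u \<in> cone hull K"
    "AE w in lborel. (w \<in> cone hull K \<longrightarrow>
        minkowski K (q + w) = minkowski K q + minkowski K w \<and>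
        minkowski K (q + u + w) = minkowski K (q + u) + minkowski K w) \<and>
      (q + w \<in> cone hull K \<longrightarrow> q + u + w \<in> cone hull K \<longrightarrow> w \<in> cone hull K)"
proof -
  let ?y = "diag u :: real ^ 'n ^ 'p"
  have y: "?y \<in> cone hull R" by (rule diag_mem_cone[OF eq int])
  obtain x where x: "\<And>l. x l \<in> cone hull K" "(\<Sum>l\<in>UNIV. minkowski K (x l)) \<le> minkowski R ?y"
      "\<And>i. ?y $ i = t $ Some i *\<^sub>R x (Some i) - t $ None *\<^sub>R x None"
      "\<And>w. exp_gauge R ?y * exp_gauge K (rate *\<^sub>R w) \<le> fibre_density t K ?y (t $ None *\<^sub>R x None + w)"
    using fibre_density_ge[OF y] by metis
  \<comment> \<open>All components of \<open>?y\<close> equal \<open>u\<close>, so every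
    \<open>t $ Some i *\<^sub>R x (Some i)\<close> is the same point \<open>q + u\<close>.\<close>
  define q where "q = t $ None *\<^sub>R x None"
  have q: "q + u = t $ Some i *\<^sub>R x (Some i)" for i
    using x(3)[of i] by (simp add: q_def)
  have meas: "(\<lambda>w. fibre_density t K ?y (q + w)) \<in> borel_measurable borel"
    by (rule measurable_compose[OF _ fibre_density_fibre_measurable]) measurable
  have lower: "(\<integral>\<^sup>+w. ennreal (exp_gauge R ?y * exp_gauge K (rate *\<^sub>R w)) \<partial>lborel) =
      ennreal (exp_gauge R ?y) * (\<integral>\<^sup>+w. ennreal (exp_gauge K (rate *\<^sub>R w)) \<partial>lborel)"
    by (subst nn_integral_cmult[symmetric]) (auto simp: ennreal_mult)
  have "AE w in lborel. ennreal (fibre_density t K ?y (q + w)) =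
      ennreal (exp_gauge R ?y * exp_gauge K (rate *\<^sub>R w))"
  proof (rule AE_eq_of_nn_integral_eq)
    show "(\<integral>\<^sup>+w. ennreal (exp_gauge R ?y * exp_gauge K (rate *\<^sub>R w)) \<partial>lborel) =
        (\<integral>\<^sup>+w. ennreal (fibre_density t K ?y (q + w)) \<partial>lborel)"
      using nn_integral_shift[of "\<lambda>w. ennreal (fibre_density t K ?y w)" q]
      by (simp add: lower fibre_integral_eq[OF eq])
    show "(\<integral>\<^sup>+w. ennreal (exp_gauge R ?y * exp_gauge K (rate *\<^sub>R w)) \<partial>lborel) \<noteq> \<infinity>"
      by (simp add: lower rate_integral ennreal_mult_eq_top_iff)
  qed (use meas x(4) in \<open>auto simp: q_def intro: ennreal_leI\<close>)
  then have "AE w in lborel. (w \<in> cone hull K \<longrightarrow>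
        minkowski K (q + w) = minkowski K q + minkowski K w \<and>
        minkowski K (q + u + w) = minkowski K (q + u) + minkowski K w) \<and>
      (q + w \<in> cone hull K \<longrightarrow> q + u + w \<in> cone hull K \<longrightarrow> w \<in> cone hull K)"
  proof eventually_elim
    case (elim w)
    then have w: "(\<Prod>l\<in>UNIV. exp_gauge K (x l + w /\<^sub>R t $ l)) =
        exp_gauge R ?y * (\<Prod>l\<in>UNIV. exp_gauge K (w /\<^sub>R t $ l))"
      by (simp add: fibre_density_nonneg q_def exp_gauge_rate flip: fibre_density_shift[OF x(3)])
    have add: "minkowski K (t $ l *\<^sub>R x l + w) = minkowski K (t $ l *\<^sub>R x l) + minkowski K w"
      if wC: "w \<in> cone hull K" for l
    proof -
      have sc: "w /\<^sub>R t $ l \<in> cone hull K" for l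
        using wC t_pos by (simp add: scale_cone less_imp_le)
      have "exp (- (\<Sum>l\<in>UNIV. minkowski K (x l + w /\<^sub>R t $ l))) =
          exp (- minkowski R ?y - (\<Sum>l\<in>UNIV. minkowski K (w /\<^sub>R t $ l)))"
        using w y x(1) sc by (simp add: prod_exp_gauge add_cone exp_gauge_def[of R] exp_diff exp_minus divide_inverse)
      then have ge: "(\<Sum>l\<in>UNIV. minkowski K (x l) + minkowski K (w /\<^sub>R t $ l)) \<le>
          (\<Sum>l\<in>UNIV. minkowski K (x l + w /\<^sub>R t $ l))"
        using x(2) by (simp add: sum.distrib)
      have le: "minkowski K (x l + w /\<^sub>R t $ l) \<le> minkowski K (x l) + minkowski K (w /\<^sub>R t $ l)" for l
        by (intro minkowski_add x sc)
      \<comment> \<open>The total is at least the sum of the upper bounds, so no single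
        subadditivity inequality can be strict.\<close>
      from sum_mono_inv[OF antisym[OF sum_mono[OF le] ge] le] have "minkowski K (x l + w /\<^sub>R t $ l) = minkowski K (x l) + minkowski K (w /\<^sub>R t $ l)"
        by simp
      then have "minkowski K (t $ l *\<^sub>R (x l + w /\<^sub>R t $ l)) =
          minkowski K (t $ l *\<^sub>R x l) + minkowski K (t $ l *\<^sub>R (w /\<^sub>R t $ l))"
        using t_pos x(1) sc by (simp add: minkowski_scale add_cone less_imp_le distrib_left del: scaleR_scaleR)
      then show ?thesis using t_pos[of l] by (simp add: scaleR_add_right)
    qed
    \<comment> \<open>For \<open>w\<close> off the cone the product equation makes some left-hand
      factor vanish. Scaled by \<open>t $ l\<close>, its argument is \<open>q + w\<close> for
      \<open>None\<close> and \<open>q + u + w\<close> otherwise.\<close>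
    have "w \<in> cone hull K" if "q + w \<in> cone hull K" "q + u + w \<in> cone hull K"
    proof (rule ccontr)
      assume "w \<notin> cone hull K"
      then have "(\<Prod>l\<in>UNIV. exp_gauge K (x l + w /\<^sub>R t $ l)) = 0"
        using t_pos unfolding w by (simp add: exp_gauge_def scale_cone_iff prod_option)
      then obtain l where "x l + w /\<^sub>R t $ l \<notin> cone hull K"
        by (auto simp: exp_gauge_def split: if_splits)
      then have "t $ l *\<^sub>R x l + w \<notin> cone hull K"
        using scale_cone_iff[OF t_pos, of l "x l + w /\<^sub>R t $ l"] t_pos[of l] by (simp add: scaleR_add_right)
      with that show False by (cases l) (auto simp: q[symmetric] simp flip: q_def)
    qed
    with add[of None] add[of "Some undefined"] show ?case by (simp add: q_def[symmetric] q[symmetric])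
  qed
  moreover have "q \<in> cone hull K" "q + u \<in> cone hull K"
    using x(1) t_pos q[of undefined] by (auto simp: q_def less_imp_le scale_cone)
  ultimately show ?thesis using that by blast
qed

end

section \<open>Additivity of the gauge and lattice cones\<close>

text \<open>Keeps the conclusion of \<open>diag_fibre_rigid\<close> as a property of the body alone:
  \<open>t\<close> and \<open>R\<close> disappear and only the geometry of the cone remains.\<close>

locale rigid_body = gauge_body +
  assumes cone_int: "interior (cone hull B) \<noteq> {}"
    and rigid: "\<And>u. \<exists>q. q \<in> cone hull B \<and> q + u \<in> cone hull B \<and>
      (AE w in lborel. (w \<in> cone hull B \<longrightarrow>
          minkowski B (q + w) = minkowski B q + minkowski B w \<and>
          minkowski B (q + u + w) = minkowski B (q + u) + minkowski B w) \<and>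
        (q + w \<in> cone hull B \<longrightarrow> q + u + w \<in> cone hull B \<longrightarrow> w \<in> cone hull B))"
begin

abbreviation C :: "'a set" where "C \<equiv> cone hull B"

abbreviation N :: "'a \<Rightarrow> real" where "N \<equiv> minkowski B"

lemma int_C: "x \<in> interior C \<Longrightarrow> x \<in> C"
  using interior_subset by blast

text \<open>The sum is twice the midpoint of a closure point and an interior point, and that
  midpoint is interior.\<close>

lemma closure_add_interior:
  assumes "x \<in> closure C" "y \<in> interior C"
  shows "x + y \<in> interior C"
proof -
  have "x - (1/2) *\<^sub>R (x - y) \<in> interior C"
    by (rule mem_interior_closure_convex_shrink[OF cone_convex]) (use assms in auto)
  moreover have "2 *\<^sub>R (x - (1/2) *\<^sub>R (x - y)) = x + y"
    by (simp add: scaleR_diff_right scaleR_2)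
  ultimately show ?thesis
    using scale_interior[of "x - (1/2) *\<^sub>R (x - y)" 2] by simp
qed

lemma add_interior: "x \<in> C \<Longrightarrow> y \<in> interior C \<Longrightarrow> x + y \<in> interior C"
  using closure_add_interior closure_subset by blast

lemma eq_on_interior_of_AE:
  assumes q: "q \<in> C" and ae: "AE w in lborel. w \<in> C \<longrightarrow> N (q + w) = N q + N w"
    and w: "w \<in> interior C"
  shows "N (q + w) = N q + N w"
proof -
  obtain W where W: "\<And>k. W k \<in> interior C" "\<And>k. W k \<in> C \<longrightarrow> N (q + W k) = N q + N (W k)" "W \<longlonglongrightarrow> w"
    using AE_lborel_sequence[OF ae open_interior w] by blast
  have cont: "isCont N x" if "x \<in> interior C" for x
    using continuous_on_minkowski that by (simp add: continuous_on_eq_continuous_at)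
  have "(\<lambda>k. N (q + W k)) \<longlonglongrightarrow> N (q + w)"
    by (rule isCont_tendsto_compose[OF cont[OF add_interior[OF q w]]]) (intro tendsto_intros W)
  moreover have "(\<lambda>k. N q + N (W k)) \<longlonglongrightarrow> N q + N w"
    by (intro tendsto_intros isCont_tendsto_compose[OF cont[OF w]] W)
  ultimately show ?thesis
    using W(1,2) int_C by (simp add: LIMSEQ_unique)
qed

text \<open>Limits remove the exceptional null sets. The last implication reaches only
  \<open>closure C\<close>, because \<open>closed_C\<close> itself rests on additivity.\<close>

lemma rigid_interior:
  obtains q where "q \<in> C" "q + u \<in> C"
    "\<And>w. w \<in> interior C \<Longrightarrow> N (q + w) = N q + N w"
    "\<And>w. w \<in> interior C \<Longrightarrow> N (q + u + w) = N (q + u) + N w"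
    "\<And>w. q + w \<in> C \<Longrightarrow> q + u + w \<in> C \<Longrightarrow> w \<in> closure C"
proof -
  obtain q where q: "q \<in> C" "q + u \<in> C"
    and ae: "AE w in lborel. (w \<in> C \<longrightarrow> N (q + w) = N q + N w \<and> N (q + u + w) = N (q + u) + N w) \<and>
        (q + w \<in> C \<longrightarrow> q + u + w \<in> C \<longrightarrow> w \<in> C)"
    using rigid by blast
  show ?thesis
  proof (rule that[OF q])
    fix w assume w: "w \<in> interior C"
    show "N (q + w) = N q + N w"
      by (rule eq_on_interior_of_AE[OF q(1) _ w]) (use ae in eventually_elim, blast)
    show "N (q + u + w) = N (q + u) + N w"
      by (rule eq_on_interior_of_AE[OF q(2) _ w]) (use ae in eventually_elim, blast)
  next
    fix w assume w: "q + w \<in> C" "q + u + w \<in> C"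
    obtain v where v: "v \<in> interior C" using cone_int by blast
    let ?U = "(\<lambda>w. q + w) -` interior C \<inter> (\<lambda>w. q + u + w) -` interior C"
    have "open ?U" by (intro open_Int open_vimage continuous_intros open_interior)
    have ae': "AE w in lborel. q + w \<in> C \<longrightarrow> q + u + w \<in> C \<longrightarrow> w \<in> C"
      using ae by eventually_elim blast
    have cl: "z \<in> closure C" if z: "z \<in> ?U" for z
    proof -
      obtain Z where Z: "\<And>k. Z k \<in> ?U"
          "\<And>k. q + Z k \<in> C \<longrightarrow> q + u + Z k \<in> C \<longrightarrow> Z k \<in> C" "Z \<longlonglongrightarrow> z"
        by (rule AE_lborel_sequence[OF ae' \<open>open ?U\<close> z]) (rule that; assumption)
      have "Z k \<in> C" for k
        using Z(2)[of k] Z(1)[of k] int_C by simp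
      with Z(3) show ?thesis unfolding closure_sequential by blast
    qed
    have "w + inverse (real (Suc k)) *\<^sub>R v \<in> closure C" for k
    proof (rule cl)
      have "inverse (real (Suc k)) *\<^sub>R v \<in> interior C" by (intro scale_interior v) simp
      from add_interior[OF w(1) this] add_interior[OF w(2) this]
      show "w + inverse (real (Suc k)) *\<^sub>R v \<in> ?U" by (simp add: add.assoc)
    qed
    moreover have "(\<lambda>k. w + inverse (real (Suc k)) *\<^sub>R v) \<longlonglongrightarrow> w + 0 *\<^sub>R v"
      by (intro tendsto_intros LIMSEQ_inverse_real_of_nat)
    ultimately show "w \<in> closure C"
      using closed_sequentially[OF closed_closure, of "\<lambda>k. w + inverse (real (Suc k)) *\<^sub>R v" C] by simp
  qed
qed

text \<open>For \<open>u\<close> in the cone the supremum \<open>q\<close> of \<open>0\<close> and \<open>- u\<close> is \<open>0\<close>, and rigidity becomes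
  additivity.\<close>

lemma N_add_interior:
  assumes u: "u \<in> C" and w: "w \<in> interior C"
  shows "N (u + w) = N u + N w"
proof -
  obtain q where q: "q \<in> C" "\<And>w. w \<in> interior C \<Longrightarrow> N (q + w) = N q + N w"
    "\<And>w. w \<in> interior C \<Longrightarrow> N (q + u + w) = N (q + u) + N w"
    "\<And>w. q + w \<in> C \<Longrightarrow> q + u + w \<in> C \<Longrightarrow> w \<in> closure C"
    using rigid_interior[of u] by metis
  \<comment> \<open>At \<open>w = - q\<close> the two premises read \<open>0 \<in> C\<close> and
    \<open>u \<in> C\<close>.\<close>
  have "- q \<in> closure C" using q(4)[of "- q"] u by simp
  obtain v where v: "v \<in> interior C" using cone_int by blast
  \<comment> \<open>Additivity at the interior point \<open>- q + e *\<^sub>R v\<close> bounds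
    \<open>N q\<close> by \<open>N (e *\<^sub>R v)\<close>, which is arbitrarily small.\<close>
  have le: "N q \<le> e * N v" if "0 < e" for e
  proof -
    have e: "e *\<^sub>R v \<in> interior C" using scale_interior[OF v that] .
    from q(2)[OF closure_add_interior[OF \<open>- q \<in> closure C\<close> e]]
    have "N (e *\<^sub>R v) = N q + N (- q + e *\<^sub>R v)" by simp
    moreover have "0 \<le> N (- q + e *\<^sub>R v)"
      using closure_add_interior[OF \<open>- q \<in> closure C\<close> e] by (intro minkowski_nonneg int_C)
    ultimately show ?thesis using that v by (simp add: minkowski_scale int_C)
  qed
  then have "N q \<le> 0 + e" if "0 < e" for e
  proof -
    have Nv: "0 \<le> N v" using v by (intro minkowski_nonneg int_C)
    have "N q \<le> (e / (N v + 1)) * N v" by (rule le) (use that Nv in simp)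
    also have "\<dots> \<le> e" using that Nv by (simp add: field_simps)
    finally show ?thesis by simp
  qed
  then have "N q \<le> 0" by (rule field_le_epsilon)
  then have "q = 0" using minkowski_nonneg[OF q(1)] minkowski_eq_0_iff[OF q(1)] by simp
  then show ?thesis using q(3)[OF w] by simp
qed

lemma N_add:
  assumes u: "u \<in> C" and w: "w \<in> C"
  shows "N (u + w) = N u + N w"
proof -
  obtain v where v: "v \<in> interior C" using cone_int by blast
  have "N (u + w) + N v = N (u + (w + v))"
    using N_add_interior[OF add_cone[OF u w] v] by (simp add: add.assoc)
  also have "\<dots> = N u + (N w + N v)"
    using N_add_interior[OF u add_interior[OF w v]] N_add_interior[OF w v] by simp
  finally show ?thesis by simp
qed

text \<open>Additivity makes \<open>N\<close> monotone for the cone order. The points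
  \<open>?X k\<close> lie below \<open>x + v\<close>, hence in one fixed closed dilate of
  \<open>B\<close>, which therefore contains their limit \<open>x\<close>.\<close>

lemma closed_C: "closed C"
proof -
  obtain v where v: "v \<in> interior C" using cone_int by blast
  have "x \<in> C" if x: "x \<in> closure C" for x
  proof -
    let ?s = "N (x + v)" and ?X = "\<lambda>k. x + inverse (real (Suc k)) *\<^sub>R v"
    have xv: "x + v \<in> C" using closure_add_interior[OF x v] by (rule int_C)
    have "?X k \<in> (*\<^sub>R) ?s ` B" for k
    proof -
      let ?e = "inverse (real (Suc k))"
      have "?e \<le> 1" by (simp add: inverse_le_1_iff)
      have X: "?X k \<in> C" using closure_add_interior[OF x scale_interior[OF v, of ?e]] by (intro int_C) simp
      have r: "(1 - ?e) *\<^sub>R v \<in> C" using v \<open>?e \<le> 1\<close> by (intro scale_cone int_C) simp_all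
      have eq: "?X k + (1 - ?e) *\<^sub>R v = x + v" by (simp add: algebra_simps)
      have "N (?X k) \<le> ?s" using N_add[OF X r, unfolded eq] minkowski_nonneg[OF r] by linarith
      with X show ?thesis using mem_scale_iff minkowski_nonneg[OF xv] by blast
    qed
    moreover have "?X \<longlonglongrightarrow> x + 0 *\<^sub>R v" by (intro tendsto_intros LIMSEQ_inverse_real_of_nat)
    ultimately have "x \<in> (*\<^sub>R) ?s ` B"
      using closed_sequentially[OF closed_scale[OF minkowski_nonneg[OF xv]], of ?X x] by simp
    then show ?thesis using minkowski_nonneg[OF xv] by (auto simp: mem_cone_hull_iff)
  qed
  then show ?thesis unfolding closure_subset_eq[symmetric] by blast
qed

text \<open>With \<open>closure C\<close> equal to \<open>C\<close>, the point from
  \<open>rigid_interior\<close> is the least upper bound of \<open>0\<close> and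
  \<open>- u\<close>.\<close>

lemma C_lattice: "\<exists>q\<in>C. q + u \<in> C \<and> (\<forall>z\<in>C. z + u \<in> C \<longrightarrow> z - q \<in> C)"
proof -
  obtain q where "q \<in> C" "q + u \<in> C" "\<And>w. q + w \<in> C \<Longrightarrow> q + u + w \<in> C \<Longrightarrow> w \<in> C"
    using rigid_interior[of u] unfolding closure_closed[OF closed_C] by metis
  then show ?thesis by (intro bexI[of _ q]) (auto simp: algebra_simps)
qed

text \<open>Let \<open>q\<close> be the supremum of \<open>0\<close> and \<open>e - a\<close> in the
  cone order. Both \<open>e\<close> and \<open>b\<close> are upper bounds of this pair, so
  \<open>q\<close> lies below them, and \<open>f = e - q\<close> is the infimum of \<open>a\<close>
  and \<open>e\<close>.\<close>

lemma Riesz_decomposition: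
  assumes "a \<in> C" "b \<in> C" "e \<in> C" "a + b - e \<in> C"
  obtains f where "f \<in> C" "a - f \<in> C" "e - f \<in> C" "b - (e - f) \<in> C"
proof -
  obtain q where q: "q \<in> C" "q + (a - e) \<in> C" "\<And>z. z \<in> C \<Longrightarrow> z + (a - e) \<in> C \<Longrightarrow> z - q \<in> C"
    using C_lattice[of "a - e"] by blast
  show ?thesis
    using that[of "e - q"] q(1,2) q(3)[of e] q(3)[of b] assms by (simp add: algebra_simps)
qed

section \<open>Extreme points as atoms of the lattice cone\<close>

lemma C_pointed: "x \<in> C \<Longrightarrow> - x \<in> C \<Longrightarrow> x = 0"
  using N_add[of x "- x"] minkowski_nonneg[of x] minkowski_nonneg[of "- x"] minkowski_eq_0_iff[of x]
  by simp

lemma sum_mem_cone: "(\<And>j. j \<in> J \<Longrightarrow> a j \<in> C) \<Longrightarrow> sum a J \<in> C"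
  by (induction J rule: infinite_finite_induct) (auto simp: add_cone)

text \<open>If \<open>N e\<close> were below one, \<open>e\<close> would lie strictly between
  \<open>0\<close> and its normalisation, both in \<open>B\<close>.\<close>

lemma extreme_point_norm:
  assumes e: "e extreme_point_of B" "e \<noteq> 0"
  shows "e \<in> C" "N e = 1"
proof -
  have "e \<in> B" using e(1) by (simp add: extreme_point_of_def)
  then show C: "e \<in> C" by (rule hull_inc)
  have "N e \<le> 1" using \<open>e \<in> B\<close> mem_iff by blast
  have pos: "0 < N e" using minkowski_nonneg[OF C] minkowski_eq_0_iff[OF C] e(2) by linarith
  show "N e = 1"
  proof (rule ccontr)
    assume "N e \<noteq> 1"
    with \<open>N e \<le> 1\<close> have lt: "N e < 1" by simp
    let ?f = "inverse (N e) *\<^sub>R e"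
    have "?f \<in> B" using C pos by (simp add: mem_iff scale_cone minkowski_scale)
    moreover have "e \<in> open_segment 0 ?f"
      unfolding in_segment using pos lt e(2) by (intro conjI exI[of _ "N e"]) auto
    ultimately show False using e(1) zero_mem by (auto simp: extreme_point_of_def)
  qed
qed

text \<open>Additivity gives \<open>N f + N (e - f) = 1\<close>. If both gauges are positive,
  \<open>e\<close> is a proper convex combination of the normalisations of \<open>f\<close> and
  \<open>e - f\<close>, which extremality forces to coincide.\<close>

lemma extreme_point_atom:
  assumes e: "e extreme_point_of B" "e \<noteq> 0" and f: "f \<in> C" "e - f \<in> C"
  shows "\<exists>\<alpha>\<ge>0. f = \<alpha> *\<^sub>R e"
proof -
  have sum: "N f + N (e - f) = 1"
    using N_add[OF f] extreme_point_norm[OF e] by simp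
  have nn: "0 \<le> N f" "0 \<le> N (e - f)" using f by (auto intro: minkowski_nonneg)
  consider "N f = 0" | "N (e - f) = 0" | "0 < N f" "0 < N (e - f)" using nn by linarith
  then show ?thesis
  proof cases
    case 1
    then show ?thesis using f by (intro exI[of _ 0]) (simp add: minkowski_eq_0_iff)
  next
    case 2
    then show ?thesis using f by (intro exI[of _ 1]) (simp add: minkowski_eq_0_iff)
  next
    case 3
    let ?a = "inverse (N (e - f)) *\<^sub>R (e - f)" and ?b = "inverse (N f) *\<^sub>R f"
    have ab: "?a \<in> B" "?b \<in> B" using f 3 by (simp_all add: mem_iff scale_cone minkowski_scale)
    have comb: "e = (1 - N f) *\<^sub>R ?a + N f *\<^sub>R ?b"
      using 3 sum by (simp add: eq_diff_eq[symmetric] add.commute)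
    have "?a = ?b"
    proof (rule ccontr)
      assume "?a \<noteq> ?b"
      then have "e \<in> open_segment ?a ?b"
        unfolding in_segment using comb 3 sum by (intro conjI exI[of _ "N f"]) auto
      with ab e(1) show False by (auto simp: extreme_point_of_def)
    qed
    with comb have "e = (1 - N f) *\<^sub>R ?b + N f *\<^sub>R ?b" by argo
    then have "e = ?b" unfolding scaleR_left_distrib[symmetric] by simp
    then have "f = N f *\<^sub>R e" using 3 by simp
    then show ?thesis using nn by blast
  qed
qed

text \<open>Riesz decomposition splits the multiple of \<open>e\<close> into a part \<open>f\<close>
  below \<open>a j\<close> and a part below the remaining sum. As \<open>e\<close> is an atom,
  \<open>f\<close> is a multiple of \<open>e\<close>: if positive, \<open>j\<close> works; if zero,
  the whole multiple passes to the remaining sum.\<close>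

lemma extreme_point_below_sum:
  assumes e: "e extreme_point_of B" "e \<noteq> 0" and J: "finite J"
    and "\<And>j. j \<in> J \<Longrightarrow> a j \<in> C" "0 < \<epsilon>" "(\<Sum>j\<in>J. a j) - \<epsilon> *\<^sub>R e \<in> C"
  shows "\<exists>j\<in>J. \<exists>\<delta>>0. a j - \<delta> *\<^sub>R e \<in> C"
  using J assms(4-)
proof (induction J)
  case empty
  then have "\<epsilon> *\<^sub>R e = 0"
    using extreme_point_norm(1)[OF e] by (intro C_pointed) (simp_all add: scale_cone)
  with empty e show ?case by simp
next
  case (insert j J)
  let ?S = "\<Sum>j\<in>J. a j"
  have eC: "\<epsilon> *\<^sub>R e \<in> C" using insert.prems extreme_point_norm(1)[OF e] by (simp add: scale_cone)
  have "?S \<in> C"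
    using insert.prems(1) by (intro sum_mem_cone) simp
  moreover have "a j \<in> C" using insert.prems by simp
  moreover have "a j + ?S - \<epsilon> *\<^sub>R e \<in> C" using insert by simp
  ultimately obtain f where f: "f \<in> C" "a j - f \<in> C" "\<epsilon> *\<^sub>R e - f \<in> C" "?S - (\<epsilon> *\<^sub>R e - f) \<in> C"
    using Riesz_decomposition eC by metis
  have "e - inverse \<epsilon> *\<^sub>R f \<in> C"
    using scale_cone[OF f(3), of "inverse \<epsilon>"] insert.prems(2) by (simp add: scaleR_diff_right)
  then obtain \<alpha> where \<alpha>: "0 \<le> \<alpha>" "inverse \<epsilon> *\<^sub>R f = \<alpha> *\<^sub>R e"
    using extreme_point_atom[OF e, of "inverse \<epsilon> *\<^sub>R f"] f(1) insert.prems(2) by (auto simp: scale_cone)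
  then have f_eq: "f = (\<epsilon> * \<alpha>) *\<^sub>R e"
    using insert.prems(2) by (metis scaleR_scaleR scaleR_one right_inverse less_irrefl)
  show ?case
  proof (cases "\<alpha> = 0")
    case True
    then have "?S - \<epsilon> *\<^sub>R e \<in> C" using f f_eq by simp
    then show ?thesis using insert by auto
  next
    case False
    then have "0 < \<epsilon> * \<alpha>" using \<alpha> insert.prems by simp
    then show ?thesis using f(2) f_eq by auto
  qed
qed

text \<open>Separating a linear relation by sign puts a positive multiple of \<open>v0\<close> below
  a positive combination of other extreme points, hence below a multiple of a single
  \<open>v\<close>. As \<open>v\<close> is an atom, the two are proportional, and equal gauges give
  \<open>v0 = v\<close>, against the opposite signs.\<close>

lemma independent_extreme_points: "independent ({x. x extreme_point_of B} - {0})"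
proof
  assume "dependent ({x. x extreme_point_of B} - {0})"
  then obtain T c v0 where T: "finite T" "T \<subseteq> {x. x extreme_point_of B} - {0}"
    and c: "v0 \<in> T" "c v0 \<noteq> 0" "(\<Sum>v\<in>T. c v *\<^sub>R v) = 0"
    unfolding dependent_explicit by blast
  obtain d where d: "0 < d v0" "(\<Sum>v\<in>T. d v *\<^sub>R v) = 0"
  proof (cases "0 < c v0")
    case True
    with c that show ?thesis by blast
  next
    case False
    with c that[of "\<lambda>v. - c v"] show ?thesis by (simp add: sum_negf)
  qed
  have ext: "v extreme_point_of B" "v \<noteq> 0" if "v \<in> T" for v using T that by auto
  let ?P = "{v \<in> T. 0 \<le> d v}" and ?Q = "{v \<in> T. d v < 0}"
  have "0 = (\<Sum>v\<in>?P \<union> ?Q. d v *\<^sub>R v)"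
    unfolding d(2)[symmetric] by (intro sum.cong) auto
  also have "\<dots> = (\<Sum>v\<in>?P. d v *\<^sub>R v) + (\<Sum>v\<in>?Q. d v *\<^sub>R v)"
    using T by (intro sum.union_disjoint) auto
  also have "(\<Sum>v\<in>?P. d v *\<^sub>R v) = d v0 *\<^sub>R v0 + (\<Sum>v\<in>?P - {v0}. d v *\<^sub>R v)"
    using T c d by (intro sum.remove) auto
  finally have "(\<Sum>v\<in>?Q. (- d v) *\<^sub>R v) - d v0 *\<^sub>R v0 = (\<Sum>v\<in>?P - {v0}. d v *\<^sub>R v)"
    by (simp add: sum_negf algebra_simps neg_eq_iff_add_eq_0)
  also have "\<dots> \<in> C"
    using ext extreme_point_norm(1) by (intro sum_mem_cone) (auto simp: scale_cone)
  finally obtain v \<delta> where v: "v \<in> ?Q" "0 < \<delta>" "(- d v) *\<^sub>R v - \<delta> *\<^sub>R v0 \<in> C"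
    using extreme_point_below_sum[OF ext[OF c(1)], of ?Q "\<lambda>v. (- d v) *\<^sub>R v" "d v0"] T d(1) ext extreme_point_norm(1)
    by (auto simp: scale_cone simp del: scaleR_minus_left)
  \<comment> \<open>Dividing by the positive number \<open>- d v\<close> turns the bound for a
    multiple of \<open>v\<close> into one for \<open>v\<close> itself.\<close>
  let ?\<beta> = "inverse (- d v) * \<delta>"
  have "0 < ?\<beta>" using v by (intro mult_pos_pos) auto
  have "v - ?\<beta> *\<^sub>R v0 \<in> C"
  proof -
    have "inverse (- d v) *\<^sub>R ((- d v) *\<^sub>R v - \<delta> *\<^sub>R v0) \<in> C"
      using v by (intro scale_cone) auto
    moreover have "inverse (- d v) * (- d v) = 1" using v(1) by auto
    ultimately show ?thesis by (simp add: scaleR_diff_right del: inverse_minus_eq mult_minus_right mult_minus_left scaleR_minus_left scaleR_minus_right)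
  qed
  moreover have v0: "v0 \<in> C" "N v0 = 1" "v \<in> C" "N v = 1" using extreme_point_norm ext c(1) v(1) by auto
  moreover have "?\<beta> *\<^sub>R v0 \<in> C" using v0 \<open>0 < ?\<beta>\<close> by (intro scale_cone) auto
  ultimately obtain \<alpha> where \<alpha>: "0 \<le> \<alpha>" "?\<beta> *\<^sub>R v0 = \<alpha> *\<^sub>R v"
    using extreme_point_atom[OF ext] v(1) by blast
  then have "N (?\<beta> *\<^sub>R v0) = N (\<alpha> *\<^sub>R v)" by simp
  then have "?\<beta> = \<alpha>"
    using v0 \<alpha>(1) \<open>0 < ?\<beta>\<close> less_imp_le[OF \<open>0 < ?\<beta>\<close>] by (simp only: minkowski_scale mult_1_right)
  with \<alpha> \<open>0 < ?\<beta>\<close> have "v0 = v" by (metis less_irrefl scaleR_cancel_left)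
  with v d show False by simp
qed

lemma zero_extreme_point: "0 extreme_point_of B"
  unfolding extreme_point_of_def
proof (intro conjI zero_mem ballI notI)
  fix a b assume ab: "a \<in> B" "b \<in> B" "0 \<in> open_segment a b"
  then obtain s where s: "0 < s" "s < 1" "0 = (1 - s) *\<^sub>R a + s *\<^sub>R b" "a \<noteq> b"
    by (auto simp: in_segment)
  have C: "(1 - s) *\<^sub>R a \<in> C" "s *\<^sub>R b \<in> C"
    using ab s by (auto intro!: scale_cone simp: mem_iff)
  moreover have "s *\<^sub>R b = - ((1 - s) *\<^sub>R a)" using s(3) by (metis add.commute add.inverse_unique add_eq_0_iff)
  ultimately have "(1 - s) *\<^sub>R a = 0" using C_pointed by metis
  then show False using s by simp
qed

text \<open>The extreme points generate \<open>B\<close>, and since \<open>0\<close> is one of them,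
  their affine independence amounts to linear independence of the others.\<close>

lemma simplex: "\<exists>V. \<not> affine_dependent V \<and> B = convex hull V \<and> 0 \<in> V"
proof (intro exI conjI)
  let ?V = "{x. x extreme_point_of B}"
  show "B = convex hull ?V" by (rule Krein_Milman_Minkowski[OF comp conv])
  show "0 \<in> ?V" using zero_extreme_point by simp
  then have "?V = insert 0 (?V - {0})" by blast
  moreover have "\<not> affine_dependent (insert 0 (?V - {0}))"
    by (subst affine_dependent_iff_dependent) (simp_all add: independent_extreme_points)
  ultimately show "\<not> affine_dependent ?V" by metis
qed

end

section \<open>Positivity of the weights and the final assembly\<close>

lemma rel_interior_Theta_pos:
  assumes "t \<in> rel_interior Theta"
  shows "0 < t $ l"
proof -
  have "convex Theta"
    by (auto simp: convex_def Theta_def sum.distrib sum_distrib_left[symmetric])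
  have vertex: "axis l 1 \<in> Theta"
    by (auto simp: Theta_def axis_def)
  \<comment> \<open>The segment from the vertex through \<open>t\<close> can be prolonged slightly
    within \<open>Theta\<close>; the coordinate \<open>l\<close> of the new point is nonnegative
    although \<open>1 - e\<close> is negative.\<close>
  with assms obtain e where e: "1 < e" "(1 - e) *\<^sub>R axis l 1 + e *\<^sub>R t \<in> Theta"
    using convex_rel_interior_iff[OF \<open>convex Theta\<close>, of t] by blast
  then have "0 \<le> 1 - e + e * t $ l"
    by (auto simp: Theta_def dest: spec[of _ l])
  then have "0 < e * t $ l" using e(1) by linarith
  then show ?thesis using e(1) by (simp add: zero_less_mult_iff)
qed

lemma interior_full_dimensional:
  fixes S :: "'a::euclidean_space set"
  assumes "convex S" "aff_dim S = int DIM('a)"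
  shows "interior S \<noteq> {}"
proof -
  have "S \<noteq> {}" using assms(2) by auto
  moreover have "rel_interior S = interior S"
    using assms(2) by (intro rel_interior_interior) (simp add: aff_dim_eq_full)
  ultimately show ?thesis using rel_interior_eq_empty[OF assms(1)] by metis
qed

theorem theorem9p1:
  fixes K :: "(real ^ 'n) set"
  assumes "CARD('n) \<ge> 2"
    and "convex_body K"
    and "0 \<in> K"
  shows "(\<forall>t \<in> (Theta :: (real ^ ('p::finite option)) set).
            measure lebesgue (R_body t K) \<le> R_bound t K) \<and>
         (aff_dim K = int CARD('n) \<and>
          (\<exists>t \<in> rel_interior (Theta :: (real ^ ('p option)) set).
             measure lebesgue (R_body t K) = R_bound t K)
          \<longrightarrow> simplex_with_vertex K 0)"
proof (intro conjI ballI impI)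
  interpret gauge_body K
    using assms(2,3) by unfold_locales (auto simp: convex_body_def)
  show "measure lebesgue (R_body t K) \<le> R_bound t K" if "t \<in> Theta" for t :: "real ^ 'p option"
    using that by (intro measure_R_body_le gauge_body_axioms) (simp add: Theta_def)
  assume "aff_dim K = int CARD('n) \<and> (\<exists>t \<in> rel_interior (Theta :: (real ^ ('p option)) set).
    measure lebesgue (R_body t K) = R_bound t K)"
  then obtain t :: "real ^ 'p option" where dim: "aff_dim K = int CARD('n)"
    and t: "t \<in> rel_interior Theta" and eq: "measure lebesgue (R_body t K) = R_bound t K"
    by blast
  interpret weighted_body K t
    by unfold_locales (rule rel_interior_Theta_pos[OF t])
  have "interior K \<noteq> {}"
    using dim by (intro interior_full_dimensional conv) simp
  then have int: "interior (cone hull K) \<noteq> {}"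
    using interior_mono[OF hull_subset[of K cone]] by blast
  interpret rigid_body K
    by unfold_locales (rule int, rule diag_fibre_rigid[OF eq int], (intro exI conjI; assumption))
  show "simplex_with_vertex K 0"
    unfolding simplex_with_vertex_def by (rule simplex)
qed

end
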